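(* Let $n\ge 2$, $c\ge 1$, and $\tau,\delta\in(0,1)$. Suppose that $G$ is a $c$-John domain in $\mathbb{R}^n$. Then there exists a constant $C=C(n,\delta,c,\tau)>0$, depending only on $n,\delta,c,\tau$, such that the inequality $$\int_G|u(x)-u_G|^{n/(n-\delta)}\,dx\le C\biggl(\int_G\int_{B(x,\tau\,\mathrm{dist}(x,\partial G))}\frac{|u(x)-u(y)|}{|x-y|^{n+\delta}}\,dy\,dx\biggr)^{n/(n-\delta)}$$ holds for every $u\in L^1(G)$.
   Context: $\mathrm{dist}(x,\partial G)$ is the distance from $x\in G$ to the boundary of $G$, $B(x,r)$ is the ball of center $x$ and radius $r$, and $u_G=|G|^{-1}\int_G u(x)\,dx$, where $|G|$ is the Lebesgue measure of $G$. Both sides take values in $[0,\infty]$. A bounded domain (open connected set) $G$ in $\mathbb{R}^n$, $n\ge 2$, is a $c$-John domain with constant $c\ge 1$ if there exists $x_0\in G$ such that every point $x\in G$ can be joined to $x_0$ by a rectifiable curve $\gamma:[0,\ell]\to G$, parametrized by its arc length, with $\gamma(0)=x$, $\gamma(\ell)=x_0$ and $\mathrm{dist}(\gamma(t),\partial G)\ge t/c$ for every $t\in[0,\ell]$. *)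

theory Defs
  imports "HOL-Analysis.Analysis"
begin

(* Supremum of the lengths of the polygons inscribed in the curve restricted to [a, b],
   over all partitions a = t 0 <= ... <= t N = b; meaningful for a <= b. *)
definition curve_length :: "(real \<Rightarrow> 'a::metric_space) \<Rightarrow> real \<Rightarrow> real \<Rightarrow> ennreal" where
  "curve_length \<gamma> a b =
     (SUP (N, t) \<in> {(N, t). t 0 = a \<and> t N = b \<and> mono_on {..N::nat} t}.
        \<Sum>i<N. ennreal (dist (\<gamma> (t i)) (\<gamma> (t (Suc i)))))"

(* A rectifiable curve on [0, l] parametrized by its arc length. The case l = 0 is the constant
   curve at a point. Rectifiability is the instance s = l, as ennreal l is finite. *)
definition arc_length_parametrized :: "(real \<Rightarrow> 'a::metric_space) \<Rightarrow> real \<Rightarrow> bool" where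
  "arc_length_parametrized \<gamma> l \<longleftrightarrow>
     0 \<le> l \<and> continuous_on {0..l} \<gamma> \<and> (\<forall>s\<in>{0..l}. curve_length \<gamma> 0 s = ennreal s)"

definition john_domain :: "real \<Rightarrow> 'a::euclidean_space set \<Rightarrow> bool" where
  "john_domain c G \<longleftrightarrow>
     1 \<le> c \<and> open G \<and> connected G \<and> bounded G \<and>
     (\<exists>x0\<in>G. \<forall>x\<in>G. \<exists>\<gamma> l. arc_length_parametrized \<gamma> l \<and> \<gamma> ` {0..l} \<subseteq> G \<and>
        \<gamma> 0 = x \<and> \<gamma> l = x0 \<and>
        (\<forall>t\<in>{0..l}. infdist (\<gamma> t) (frontier G) \<ge> t / c))"

definition integral_average :: "'a::euclidean_space set \<Rightarrow> ('a \<Rightarrow> real) \<Rightarrow> real" where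
  "integral_average G u = (LINT x:G|lebesgue. u x) / measure lebesgue G"

(* The power x^p on [0, \<infinity>]; only meant for exponents p > 0. *)
definition ennreal_powr :: "ennreal \<Rightarrow> real \<Rightarrow> ennreal" where
  "ennreal_powr x p = (if x = \<infinity> then \<infinity> else ennreal (enn2real x powr p))"

end

theory Submission
  imports Defs
begin

text \<open>The inequality has the exponent 1 on the right, so it reduces to an isoperimetric inequality. By the
  coarea formula (\<open>nn_integral_superlevel_jump_perimeter\<close>) the double integral of \<open>u\<close> is the integral over
  \<open>t\<close> of the fractional perimeters \<open>P {x \<in> G. t < u x}\<close>, where \<open>P A\<close> is the double integral of the
  kernel over the pairs that \<open>A\<close> separates. With \<open>q = n / (n - \<delta>)\<close>, Minkowski's inequality
  (\<open>nn_integral_powr_le_superlevel_integral\<close>) bounds the \<open>L\<^sup>q\<close> norm of a nonnegative function by the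
  integral of the \<open>1/q\<close>-th powers of the measures of its superlevel sets. So it suffices that
  \<open>measure A powr (1/q) \<le> C * P A\<close> whenever \<open>A\<close> fills at most half of a fixed central ball, applied
  to the superlevel sets above a median \<open>m\<close> of \<open>u\<close> on that ball and, through \<open>- u\<close>, to the sublevel
  sets below it. Passing from \<open>m\<close> to the average of \<open>u\<close> costs a constant factor.

  The isoperimetric inequality (\<open>measure_le_jump_perimeter_powr\<close>) is where the John condition enters.
  Take a density point \<open>x\<close> of \<open>A\<close> and move a ball along the John curve from \<open>x\<close> to the centre, with
  the radius \<open>\<tau> / (3 * c) * t\<close> at time \<open>t\<close>. At first \<open>A\<close> nearly fills it, at the end \<open>A\<close> fills at most half of it;
  so at some time \<open>A\<close> fills exactly half. Such a ball of radius \<open>r\<close> contributes at least a multiple of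
  \<open>r powr (n - \<delta>)\<close> to \<open>P A\<close>, because the John condition keeps its radius at most
  \<open>\<tau> / 3\<close> times the distance of its centre from the boundary, and a fixed multiple of it contains \<open>x\<close>.
  A Vitali selection of disjoint balls gives
  \<open>measure A \<le> C * (\<Sum>i. r i powr n) \<le> C * (\<Sum>i. r i powr (n - \<delta>)) powr q \<le> C * P A powr q\<close>.\<close>

section \<open>Density points and measures of moving balls\<close>

lemma measure_Diff_Int:
  assumes "B \<in> fmeasurable M" "A \<in> sets M"
  shows "measure M (B - A) = measure M B - measure M (A \<inter> B)"
proof -
  have "A \<inter> B \<in> fmeasurable M" using fmeasurable_Int_fmeasurable[OF assms] by (simp add: Int_commute)
  from measurable_measure_Diff[OF assms(1) fmeasurableD[OF this]] show ?thesis
    by (simp add: Diff_Int_distrib2 Diff_Int)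
qed

text \<open>This is half of the Lebesgue density theorem. The exceptional set \<open>S\<close> is not known to be
  measurable, so its outer measure \<open>e\<close> is used. In an open set of measure at most \<open>e + \<epsilon>\<close> around
  \<open>S\<close>, the Vitali covering theorem gives disjoint balls that cover \<open>S\<close> up to a null set, and \<open>A\<close>
  fills at most the fraction \<open>p\<close> of each. Hence \<open>e \<le> p * (e + \<epsilon>)\<close> for all \<open>\<epsilon> > 0\<close>, and \<open>e = 0\<close>.\<close>

lemma negligible_low_density_points:
  fixes A :: "'a::euclidean_space set"
  assumes A: "A \<in> lmeasurable" and p: "0 \<le> p" "p < 1"
  shows "negligible {x \<in> A. \<forall>e>0. \<exists>d. 0 < d \<and> d < e \<and>
           measure lebesgue (A \<inter> ball x d) \<le> p * measure lebesgue (ball x d)}"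
    (is "negligible ?S")
proof -
  let ?\<mu> = "measure lebesgue :: 'a set \<Rightarrow> real"
  \<comment> \<open>Covering step: any outer approximation of \<open>S\<close> can be improved by almost the factor \<open>p\<close>.\<close>
  have improve: "\<exists>U'. ?S \<subseteq> U' \<and> U' \<in> lmeasurable \<and> ?\<mu> U' \<le> p * (?\<mu> U + \<epsilon>)"
    if U: "?S \<subseteq> U" "U \<in> lmeasurable" and \<epsilon>: "\<epsilon> > 0" for U \<epsilon>
  proof -
    obtain V where V: "open V" "U \<subseteq> V" "V - U \<in> lmeasurable" "emeasure lebesgue (V - U) < ennreal \<epsilon>"
      using sets_lebesgue_outer_open[OF fmeasurableD[OF U(2)] \<epsilon>] by blast
    have Vm: "V \<in> lmeasurable"
      using fmeasurable.Un[OF U(2) V(3)] Diff_partition[OF V(2)] by simp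
    have "?\<mu> (V - U) < \<epsilon>"
      using V(3,4) by (metis emeasure_eq_measure2 ennreal_leI not_less)
    then have \<mu>V: "?\<mu> V \<le> ?\<mu> U + \<epsilon>"
      using measurable_measure_Diff[OF Vm, of U] U V by (simp add: fmeasurableD)
    let ?K = "{(x,d). x \<in> ?S \<and> 0 < d \<and> ball x d \<subseteq> V \<and> ?\<mu> (A \<inter> ball x d) \<le> p * ?\<mu> (ball x d)}"
    have cov: "\<exists>i. i \<in> ?K \<and> x \<in> ball (fst i) (snd i) \<and> snd i < e"
      if x: "x \<in> ?S" and e: "0 < e" for x e
    proof -
      obtain e' where e': "e' > 0" "ball x e' \<subseteq> V"
        using V(1,2) U(1) x by (meson openE subsetD)
      then obtain d where d: "0 < d" "d < min e e'" "?\<mu> (A \<inter> ball x d) \<le> p * ?\<mu> (ball x d)"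
        using x e by (smt (verit) mem_Collect_eq min_less_iff_conj)
      then have "ball x d \<subseteq> V" using e' by (smt (verit) ball_subset_ball_iff min.strict_boundedE order_trans subset_ball)
      then have "(x,d) \<in> ?K" using x d by auto
      then show ?thesis using d by (intro exI[of _ "(x,d)"]) auto
    qed
    obtain C where C: "countable C" "C \<subseteq> ?K"
      "pairwise (\<lambda>i j. disjnt (ball (fst i) (snd i)) (ball (fst j) (snd j))) C"
      "negligible (?S - (\<Union>i\<in>C. ball (fst i) (snd i)))"
      by (rule Vitali_covering_theorem_balls[of ?S ?K fst snd, OF cov]) auto
    let ?D = "\<lambda>i. A \<inter> ball (fst i) (snd i)"
    let ?N = "?S - (\<Union>i\<in>C. ball (fst i) (snd i))"
    have bnd: "(\<Sum>i\<in>I. ?\<mu> (?D i)) \<le> p * ?\<mu> V" if I: "I \<subseteq> C" "finite I" for I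
    proof -
      have "(\<Sum>i\<in>I. ?\<mu> (?D i)) \<le> (\<Sum>i\<in>I. p * ?\<mu> (ball (fst i) (snd i)))"
        using I C(2) by (intro sum_mono) auto
      also have "\<dots> = p * (\<Sum>i\<in>I. ?\<mu> (ball (fst i) (snd i)))"
        by (simp add: sum_distrib_left)
      also have "(\<Sum>i\<in>I. ?\<mu> (ball (fst i) (snd i))) = ?\<mu> (\<Union>i\<in>I. ball (fst i) (snd i))"
        using I pairwise_subset[OF C(3) I(1)]
        by (intro measure_UNION'[symmetric]) auto
      also have "\<dots> \<le> ?\<mu> V"
      proof (rule measure_mono_fmeasurable[OF _ _ Vm])
        have "ball (fst i) (snd i) \<subseteq> V" if "i \<in> I" for i
        proof -
          have "i \<in> ?K" using that I(1) C(2) by blast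
          then show ?thesis by (simp add: case_prod_beta)
        qed
        then show "(\<Union>i\<in>I. ball (fst i) (snd i)) \<subseteq> V" by blast
      qed (use I in \<open>auto intro!: sets.finite_UN\<close>)
      finally show ?thesis using p(1) by (simp add: mult_left_mono)
    qed
    have UN: "(\<Union>i\<in>C. ?D i) \<in> lmeasurable \<and> ?\<mu> (\<Union>i\<in>C. ?D i) \<le> p * ?\<mu> V"
    proof -
      have D: "?D i \<in> lmeasurable" for i
        using A by (auto intro: fmeasurable.Int)
      have "?\<mu> (\<Union>i\<in>I. ?D i) \<le> p * ?\<mu> V" if I: "I \<subseteq> C" "finite I" for I
        using measure_UNION_le[of I ?D lebesgue] bnd[OF I] D I by (auto simp: fmeasurableD intro: order_trans)
      then show ?thesis
        using fmeasurable_UN_bound[OF C(1), of ?D lebesgue "p * ?\<mu> V"]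
          measure_UN_bound[OF C(1), of ?D lebesgue "p * ?\<mu> V"] D by blast
    qed
    have N: "?N \<in> lmeasurable" "?\<mu> ?N = 0"
      using C(4) by (auto simp: negligible_imp_measurable negligible_imp_measure0)
    have "?S \<subseteq> ?N \<union> (\<Union>i\<in>C. ?D i)" by auto
    moreover have "?\<mu> (?N \<union> (\<Union>i\<in>C. ?D i)) \<le> p * (?\<mu> U + \<epsilon>)"
    proof -
      have "?\<mu> (?N \<union> (\<Union>i\<in>C. ?D i)) \<le> ?\<mu> ?N + ?\<mu> (\<Union>i\<in>C. ?D i)"
        using N UN by (intro measure_Un_le) auto
      also have "\<dots> \<le> p * ?\<mu> V" using N UN by simp
      also have "\<dots> \<le> p * (?\<mu> U + \<epsilon>)" using \<mu>V p by (intro mult_left_mono) auto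
      finally show ?thesis .
    qed
    ultimately show ?thesis using N UN by (meson fmeasurable.Un)
  qed
  let ?M = "{?\<mu> U |U. ?S \<subseteq> U \<and> U \<in> lmeasurable}"
  define e where "e = Inf ?M"
  have ne: "?M \<noteq> {}" using A by auto
  have bdd: "bdd_below ?M" by (auto intro!: bdd_belowI[of _ 0])
  have "e \<le> p * (e + \<epsilon>)" if \<epsilon>: "\<epsilon> > 0" for \<epsilon>
  proof -
    have "\<exists>m\<in>?M. m < e + \<epsilon>/2"
      using cInf_lessD[OF ne, of "e + \<epsilon>/2"] \<epsilon> unfolding e_def[symmetric] by auto
    then obtain U where U: "?S \<subseteq> U" "U \<in> lmeasurable" "?\<mu> U < e + \<epsilon>/2" by auto
    then obtain U' where U': "?S \<subseteq> U'" "U' \<in> lmeasurable" "?\<mu> U' \<le> p * (?\<mu> U + \<epsilon>/2)"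
      using improve[OF U(1,2) half_gt_zero[OF \<epsilon>]] by blast
    have "e \<le> ?\<mu> U'" unfolding e_def using U' by (intro cInf_lower bdd) auto
    also have "\<dots> \<le> p * (e + \<epsilon>)" using U' U p by (smt (verit) mult_left_mono field_sum_of_halves)
    finally show ?thesis .
  qed
  then have "e \<le> p * e + \<epsilon>" if "\<epsilon> > 0" for \<epsilon>
    using that p by (smt (verit) mult_left_le_one_le ring_class.ring_distribs(1))
  then have "e \<le> p * e" by (rule field_le_epsilon)
  then have e0: "e \<le> 0" using p by (smt (verit) mult_le_cancel_right1)
  show ?thesis unfolding negligible_outer_le
  proof (intro allI impI)
    fix \<epsilon> :: real assume "\<epsilon> > 0"
    then have "\<exists>m\<in>?M. m < \<epsilon>"
      using cInf_lessD[OF ne, of "\<epsilon>"] e0 unfolding e_def[symmetric] by auto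
    then show "\<exists>T. ?S \<subseteq> T \<and> T \<in> lmeasurable \<and> ?\<mu> T \<le> \<epsilon>" by (auto intro: less_imp_le)
  qed
qed

text \<open>Spheres are null sets, so the indicators of the balls converge almost everywhere.\<close>

lemma continuous_on_measure_Int_ball:
  fixes A :: "'a::euclidean_space set" and z :: "'b::metric_space \<Rightarrow> 'a"
  assumes A: "A \<in> sets lebesgue" and z: "continuous_on S z" and r: "continuous_on S r"
  shows "continuous_on S (\<lambda>t. measure lebesgue (A \<inter> ball (z t) (r t)))"
  unfolding continuous_on_sequentially
proof (intro allI ballI impI, elim conjE)
  fix X :: "nat \<Rightarrow> 'b" and t assume X: "t \<in> S" "\<forall>n. X n \<in> S" "X \<longlonglongrightarrow> t"
  have zX: "(\<lambda>n. z (X n)) \<longlonglongrightarrow> z t" and rX: "(\<lambda>n. r (X n)) \<longlonglongrightarrow> r t"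
    using X z r by (auto simp: continuous_on_sequentially o_def)
  \<comment> \<open>All balls of the sequence lie in one ball around \<open>z t\<close>, which dominates their indicators.\<close>
  then obtain R where R: "\<And>n. r (X n) + dist (z t) (z (X n)) \<le> R"
  proof -
    have "(\<lambda>n. r (X n) + dist (z t) (z (X n))) \<longlonglongrightarrow> r t + dist (z t) (z t)"
      by (intro tendsto_intros zX rX)
    then have "Bseq (\<lambda>n. r (X n) + dist (z t) (z (X n)))"
      by (intro convergent_imp_Bseq convergentI)
    then obtain K where "\<forall>n. norm (r (X n) + dist (z t) (z (X n))) \<le> K" by (auto simp: Bseq_def)
    then show thesis by (intro that[of K]) (metis abs_ge_self order_trans real_norm_def)
  qed
  have "(\<lambda>n. \<integral>x. indicator (A \<inter> ball (z (X n)) (r (X n))) x \<partial>lebesgue)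
     \<longlonglongrightarrow> (\<integral>x. (indicator (A \<inter> ball (z t) (r t)) x :: real) \<partial>lebesgue)"
  proof (rule integral_dominated_convergence[where w="indicator (cball (z t) R)"])
    show "integrable lebesgue (indicator (cball (z t) R) :: 'a \<Rightarrow> real)"
      using emeasure_lborel_cball_finite[of "z t" R] by (simp add: integrable_indicator_iff less_top)
    have "sphere (z t) (r t) \<in> null_sets lebesgue"
      using negligible_sphere negligible_iff_null_sets by blast
    then have "AE x in lebesgue. x \<notin> sphere (z t) (r t)" by (rule AE_not_in)
    then show "AE x in lebesgue. (\<lambda>n. indicator (A \<inter> ball (z (X n)) (r (X n))) x)
        \<longlonglongrightarrow> (indicator (A \<inter> ball (z t) (r t)) x :: real)"
    proof eventually_elim
      case (elim x)
      have l: "(\<lambda>n. r (X n) - dist (z (X n)) x) \<longlonglongrightarrow> r t - dist (z t) x"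
        by (intro tendsto_intros zX rX)
      have "r t - dist (z t) x \<noteq> 0" using elim by auto
      then have "\<forall>\<^sub>F n in sequentially. (x \<in> ball (z (X n)) (r (X n))) = (x \<in> ball (z t) (r t))"
      proof (cases "r t - dist (z t) x > 0")
        case True
        from order_tendstoD(1)[OF l True] show ?thesis by eventually_elim (use True in auto)
      next
        case False
        then have "r t - dist (z t) x < 0" using \<open>r t - dist (z t) x \<noteq> 0\<close> by simp
        from order_tendstoD(2)[OF l this] show ?thesis by eventually_elim (use False in auto)
      qed
      then show ?case
        by (intro tendsto_eventually) (auto elim!: eventually_mono simp: indicator_def)
    qed
  next
    fix n
    have "ball (z (X n)) (r (X n)) \<subseteq> cball (z t) R"
      using R[of n] by (auto simp: subset_eq) (smt (verit) dist_triangle)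
    then show "AE x in lebesgue. norm (indicator (A \<inter> ball (z (X n)) (r (X n))) x :: real)
        \<le> indicator (cball (z t) R) x"
      by (intro AE_I2) (auto simp: indicator_def)
  qed (use A in \<open>auto intro!: borel_measurable_indicator sets.Int\<close>)
  then show "((\<lambda>t. measure lebesgue (A \<inter> ball (z t) (r t))) \<circ> X)
      \<longlonglongrightarrow> measure lebesgue (A \<inter> ball (z t) (r t))"
    by (simp add: o_def)
qed

section \<open>Geometry of John domains\<close>

text \<open>At \<open>x0\<close> a curve may stop at a time much smaller than the distance of \<open>x0\<close> from the boundary.
  Resting at \<open>x0\<close> until the time \<open>T = c * infdist x0 (frontier G)\<close> keeps the cone condition
  \<open>infdist (\<gamma> t) (frontier G) \<ge> t / c\<close>, and now all curves end at the same time, so that the balls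
  that travel along them end in one common ball. The
  parametrization by arc length gives \<open>dist x (\<gamma> t) \<le> t\<close>.\<close>

lemma john_domain_curves:
  fixes G :: "'a::euclidean_space set"
  assumes "john_domain c G"
  obtains x0 T where "x0 \<in> G" "T > 0"
    "\<And>x. x \<in> G \<Longrightarrow> \<exists>\<gamma>. continuous_on {0..T} \<gamma> \<and> \<gamma> T = x0 \<and>
        (\<forall>t\<in>{0..T}. dist x (\<gamma> t) \<le> t \<and> infdist (\<gamma> t) (frontier G) \<ge> t / c)"
proof -
  from assms obtain x0 where c: "1 \<le> c" and G: "open G" "bounded G" and x0: "x0 \<in> G"
    and J: "\<And>x. x \<in> G \<Longrightarrow> \<exists>\<gamma> l. arc_length_parametrized \<gamma> l \<and> \<gamma> ` {0..l} \<subseteq> G \<and>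
        \<gamma> 0 = x \<and> \<gamma> l = x0 \<and> (\<forall>t\<in>{0..l}. infdist (\<gamma> t) (frontier G) \<ge> t / c)"
    unfolding john_domain_def by blast
  define T where "T = c * infdist x0 (frontier G)"
  have "frontier G \<noteq> {}" using G x0 by (metis empty_iff frontier_eq_empty not_bounded_UNIV)
  moreover have "x0 \<notin> frontier G" using G(1) x0 by (simp add: frontier_def interior_open)
  ultimately have "infdist x0 (frontier G) > 0"
    by (metis frontier_closed in_closed_iff_infdist_zero infdist_nonneg less_eq_real_def)
  then have T: "T > 0" using c by (simp add: T_def)
  show thesis
  proof (rule that[OF x0 T])
    fix x assume "x \<in> G"
    from J[OF this] obtain \<gamma> l where \<gamma>: "arc_length_parametrized \<gamma> l" "\<gamma> 0 = x" "\<gamma> l = x0"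
      "\<forall>t\<in>{0..l}. infdist (\<gamma> t) (frontier G) \<ge> t / c" by auto
    have l: "0 \<le> l" and cont: "continuous_on {0..l} \<gamma>"
      and len: "\<And>s. s \<in> {0..l} \<Longrightarrow> curve_length \<gamma> 0 s = ennreal s"
      using \<gamma>(1) by (auto simp: arc_length_parametrized_def)
    have dist: "dist x (\<gamma> t) \<le> t" if t: "t \<in> {0..l}" for t
    proof -
      \<comment> \<open>The chord is the polygon of the partition \<open>0 \<le> t\<close>.\<close>
      let ?t = "\<lambda>i::nat. if i = 0 then 0 else t"
      have "ennreal (dist (\<gamma> 0) (\<gamma> t)) = (\<Sum>i<Suc 0. ennreal (dist (\<gamma> (?t i)) (\<gamma> (?t (Suc i)))))" by simp
      also have "\<dots> \<le> curve_length \<gamma> 0 t"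
        unfolding curve_length_def
        by (rule SUP_upper2[of "(Suc 0, ?t)"]) (use t in \<open>auto simp: mono_on_def\<close>)
      finally show ?thesis using t len[OF t] \<gamma>(2) by (simp add: ennreal_le_iff)
    qed
    have lT: "l \<le> T" using bspec[OF \<gamma>(4), of l] \<gamma>(3) l c by (simp add: T_def field_simps)
    show "\<exists>\<gamma>. continuous_on {0..T} \<gamma> \<and> \<gamma> T = x0 \<and>
        (\<forall>t\<in>{0..T}. dist x (\<gamma> t) \<le> t \<and> infdist (\<gamma> t) (frontier G) \<ge> t / c)"
    proof (intro exI[of _ "\<lambda>t. \<gamma> (min t l)"] conjI ballI)
      show "continuous_on {0..T} (\<lambda>t. \<gamma> (min t l))"
        by (rule continuous_on_compose2[OF cont]) (use l in \<open>auto intro!: continuous_intros\<close>)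
      show "\<gamma> (min T l) = x0" using lT \<gamma>(3) by simp
    next
      fix t assume t: "t \<in> {0..T}"
      show "dist x (\<gamma> (min t l)) \<le> t" using dist[of "min t l"] t l by auto
      show "t / c \<le> infdist (\<gamma> (min t l)) (frontier G)"
      proof (cases "t \<le> l")
        case True then show ?thesis using bspec[OF \<gamma>(4), of t] t by simp
      next
        case False then show ?thesis using \<gamma>(3) t c by (simp add: T_def field_simps)
      qed
    qed
  qed
qed

lemma ball_scaled_infdist_frontier_subset:
  fixes G :: "'a::euclidean_space set"
  assumes "x \<in> G" "0 \<le> \<tau>" "\<tau> \<le> 1"
  shows "ball x (\<tau> * infdist x (frontier G)) \<subseteq> G"
proof
  fix y assume "y \<in> ball x (\<tau> * infdist x (frontier G))"
  moreover have "\<tau> * infdist x (frontier G) \<le> infdist x (frontier G)"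
    using assms by (intro mult_left_le_one_le) (auto simp: infdist_nonneg)
  ultimately have y: "y \<in> ball x (infdist x (frontier G))" by simp
  show "y \<in> G"
  proof (rule ccontr)
    assume "y \<notin> G"
    moreover have "x \<in> ball x (infdist x (frontier G))"
      using y by (auto intro: le_less_trans[OF zero_le_dist])
    ultimately have "ball x (infdist x (frontier G)) \<inter> frontier G \<noteq> {}"
      using assms(1) y by (intro connected_Int_frontier connected_ball) blast+
    then show False by (metis disjoint_iff infdist_le mem_ball not_less)
  qed
qed

section \<open>The fractional perimeter\<close>

definition jump_kernel :: "'a::euclidean_space set \<Rightarrow> real \<Rightarrow> real \<Rightarrow> 'a \<times> 'a \<Rightarrow> ennreal" where
  "jump_kernel G \<tau> \<delta> = (\<lambda>(x, y).
     if x \<in> G \<and> dist x y < \<tau> * infdist x (frontier G)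
     then ennreal (1 / norm (x - y) powr (real DIM('a) + \<delta>)) else 0)"

text \<open>The fractional perimeter of \<open>A\<close>: the energy, defined below, of its indicator function.\<close>

definition jump_perimeter :: "'a::euclidean_space set \<Rightarrow> real \<Rightarrow> real \<Rightarrow> 'a set \<Rightarrow> ennreal" where
  "jump_perimeter G \<tau> \<delta> A = 
     (\<integral>\<^sup>+p. jump_kernel G \<tau> \<delta> p * indicator {(x, y). (x \<in> A) \<noteq> (y \<in> A)} p \<partial>(lborel \<Otimes>\<^sub>M lborel))"

lemma borel_measurable_infdist [measurable]:
  "(\<lambda>x. infdist x A) \<in> borel_measurable borel"
  by (intro borel_measurable_continuous_onI continuous_intros)

lemma borel_measurable_jump_kernel [measurable]:
  assumes [measurable]: "G \<in> sets borel"
  shows "jump_kernel G \<tau> \<delta> \<in> borel_measurable (lborel \<Otimes>\<^sub>M lborel)"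
  unfolding jump_kernel_def by measurable

text \<open>With radius at most \<open>\<tau> / 3\<close> times the distance \<open>d\<close> of the centre from the boundary, two
  points \<open>x\<close>, \<open>y\<close> of the ball are at distance less than \<open>2 * r\<close>, while
  \<open>\<tau> * infdist x (frontier G) \<ge> \<tau> * d - r \<ge> 2 * r\<close>. So all pairs in such a ball interact.\<close>

lemma jump_kernel_ge_on_ball:
  fixes G :: "'a::euclidean_space set"
  assumes \<tau>: "0 < \<tau>" "\<tau> < 1" and \<delta>: "0 < \<delta>"
    and r: "0 < r" "r \<le> \<tau> / 3 * infdist z (frontier G)"
    and x: "x \<in> ball z r" "x \<in> G" and y: "y \<in> ball z r" "y \<noteq> x"
  shows "ennreal (1 / (2 * r) powr (real DIM('a) + \<delta>)) \<le> jump_kernel G \<tau> \<delta> (x, y)"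
proof -
  have xy: "dist x y < 2 * r" using x y by (metis dist_commute dist_triangle_half_l mem_ball mult_2 nonzero_mult_div_cancel_left zero_neq_numeral mult.commute)
  have "infdist z (frontier G) \<le> infdist x (frontier G) + dist z x" by (rule infdist_triangle)
  then have "\<tau> * infdist z (frontier G) \<le> \<tau> * infdist x (frontier G) + \<tau> * dist z x"
    using \<tau> by (metis distrib_left mult_left_mono less_imp_le)
  moreover have "\<tau> * dist z x \<le> r"
    using \<tau> x by (smt (verit) mem_ball mult_left_le_one_le zero_le_dist)
  ultimately have "2 * r \<le> \<tau> * infdist x (frontier G)" using r by simp
  then have lt: "dist x y < \<tau> * infdist x (frontier G)" using xy by simp
  have "norm (x - y) powr (real DIM('a) + \<delta>) \<le> (2 * r) powr (real DIM('a) + \<delta>)"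
    using xy \<delta> by (intro powr_mono2) (auto simp: dist_norm)
  then have "1 / (2 * r) powr (real DIM('a) + \<delta>) \<le> 1 / norm (x - y) powr (real DIM('a) + \<delta>)"
    using y(2) by (intro divide_left_mono) (auto intro!: mult_pos_pos simp: r)
  then show ?thesis using lt x by (auto simp: jump_kernel_def intro!: ennreal_leI)
qed

text \<open>In a ball that \<open>A\<close> halves, the pairs with one point in \<open>A\<close> and the other one outside form a
  product set of measure \<open>(\<omega> * r ^ n / 2)\<^sup>2\<close>, on which the kernel is at least
  \<open>(2 * r) powr - (n + \<delta>)\<close>. The contributions of disjoint balls add up.\<close>

lemma sum_halved_balls_le_jump_perimeter:
  fixes G :: "'a::euclidean_space set"
  assumes \<tau>: "0 < \<tau>" "\<tau> < 1" and \<delta>: "0 < \<delta>"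
    and G[measurable]: "G \<in> sets borel" and A[measurable]: "A \<in> sets borel" and AG: "A \<subseteq> G"
    and I: "finite I" and disj: "disjoint_family_on (\<lambda>i. ball (z i) (r i)) I"
    and r: "\<And>i. i \<in> I \<Longrightarrow> 0 < r i \<and> r i \<le> \<tau> / 3 * infdist (z i) (frontier G)"
    and half: "\<And>i. i \<in> I \<Longrightarrow> measure lborel (A \<inter> ball (z i) (r i)) = measure lborel (ball (z i) (r i)) / 2"
  shows "(\<Sum>i\<in>I. ennreal ((unit_ball_vol (real DIM('a)))\<^sup>2 / 2 powr (real DIM('a) + \<delta> + 2) * r i powr (real DIM('a) - \<delta>)))
     \<le> jump_perimeter G \<tau> \<delta> A"
proof -
  let ?n = "real DIM('a)"
  let ?\<omega> = "unit_ball_vol (real DIM('a))"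
  let ?Q = "\<lambda>i. (A \<inter> ball (z i) (r i)) \<times> (ball (z i) (r i) - A)"
  have Q[measurable]: "?Q i \<in> sets (lborel \<Otimes>\<^sub>M lborel)" for i by (intro pair_measureI) auto
  have one: "ennreal (?\<omega>\<^sup>2 / 2 powr (?n + \<delta> + 2) * r i powr (?n - \<delta>))
      \<le> (\<integral>\<^sup>+p. jump_kernel G \<tau> \<delta> p * indicator (?Q i) p \<partial>(lborel \<Otimes>\<^sub>M lborel))" if i: "i \<in> I" for i
  proof -
    let ?B = "ball (z i) (r i)"
    have ri: "r i > 0" using r[OF i] by simp
    have B: "measure lborel ?B = ?\<omega> * r i ^ DIM('a)" using ri by (simp add: content_ball)
    have fin: "emeasure lborel (S \<inter> ?B) < \<infinity>" for S
      using emeasure_mono[of "S \<inter> ?B" ?B lborel] emeasure_lborel_ball_finite[of "z i" "r i"] by auto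
    have m1: "measure lborel (A \<inter> ?B) = ?\<omega> * r i ^ DIM('a) / 2"
      unfolding half[OF i] B ..
    then have e1: "emeasure lborel (A \<inter> ?B) = ennreal (?\<omega> * r i ^ DIM('a) / 2)"
      using fin[of A] emeasure_eq_ennreal_measure[of lborel "A \<inter> ?B", unfolded m1] by simp
    have "measure lborel (?B - A) = measure lborel ?B - measure lborel (A \<inter> ?B)"
      using emeasure_lborel_ball_finite[of "z i" "r i"]
      by (intro measure_Diff_Int) (auto simp: fmeasurable_def)
    then have m2: "measure lborel (?B - A) = ?\<omega> * r i ^ DIM('a) / 2" unfolding m1 unfolding B by simp
    have "?B - A = (- A) \<inter> ?B" by auto
    then have e2: "emeasure lborel (?B - A) = ennreal (?\<omega> * r i ^ DIM('a) / 2)"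
      using fin[of "- A"] emeasure_eq_ennreal_measure[of lborel "?B - A", unfolded m2] by simp
    have "r i powr (?n - \<delta>) = (r i ^ DIM('a))\<^sup>2 / r i powr (?n + \<delta>)"
      using ri by (simp add: powr_diff powr_add powr_realpow power2_eq_square)
    then have "?\<omega>\<^sup>2 / 2 powr (?n + \<delta> + 2) * r i powr (?n - \<delta>)
       = 1 / (2 * r i) powr (?n + \<delta>) * ((?\<omega> * r i ^ DIM('a) / 2) * (?\<omega> * r i ^ DIM('a) / 2))"
      using ri by (simp add: powr_mult powr_add power2_eq_square mult_ac)
    then have "ennreal (?\<omega>\<^sup>2 / 2 powr (?n + \<delta> + 2) * r i powr (?n - \<delta>))
      = ennreal (1 / (2 * r i) powr (?n + \<delta>)) * emeasure (lborel \<Otimes>\<^sub>M lborel) (?Q i)"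
      using ri by (simp add: lborel.emeasure_pair_measure_Times e1 e2 ennreal_mult[symmetric])
    also have "\<dots> = (\<integral>\<^sup>+p. ennreal (1 / (2 * r i) powr (?n + \<delta>)) * indicator (?Q i) p \<partial>(lborel \<Otimes>\<^sub>M lborel))"
      by (rule nn_integral_cmult_indicator[symmetric]) measurable
    also have "\<dots> \<le> (\<integral>\<^sup>+p. jump_kernel G \<tau> \<delta> p * indicator (?Q i) p \<partial>(lborel \<Otimes>\<^sub>M lborel))"
    proof (intro nn_integral_mono)
      fix p :: "'a \<times> 'a"
      show "ennreal (1 / (2 * r i) powr (?n + \<delta>)) * indicator (?Q i) p \<le> jump_kernel G \<tau> \<delta> p * indicator (?Q i) p"
        using jump_kernel_ge_on_ball[OF \<tau> \<delta>, of "r i" "z i" G "fst p" "snd p"] r[OF i] AG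
        by (cases p) (auto simp: indicator_def)
    qed
    finally show ?thesis .
  qed
  have "(\<Sum>i\<in>I. ennreal (?\<omega>\<^sup>2 / 2 powr (?n + \<delta> + 2) * r i powr (?n - \<delta>)))
    \<le> (\<Sum>i\<in>I. \<integral>\<^sup>+p. jump_kernel G \<tau> \<delta> p * indicator (?Q i) p \<partial>(lborel \<Otimes>\<^sub>M lborel))"
    by (intro sum_mono one)
  also have "\<dots> = (\<integral>\<^sup>+p. (\<Sum>i\<in>I. jump_kernel G \<tau> \<delta> p * indicator (?Q i) p) \<partial>(lborel \<Otimes>\<^sub>M lborel))"
    by (rule nn_integral_sum[symmetric]) measurable
  also have "\<dots> \<le> jump_perimeter G \<tau> \<delta> A"
    unfolding jump_perimeter_def
  proof (intro nn_integral_mono)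
    fix p :: "'a \<times> 'a"
    have "disjoint_family_on ?Q I" using disj by (auto simp: disjoint_family_on_def)
    then have "(\<Sum>i\<in>I. indicator (?Q i) p :: ennreal) = indicator (\<Union>i\<in>I. ?Q i) p"
      using I by (rule indicator_UN_disjoint[symmetric, rotated])
    also have "\<dots> \<le> indicator {(x, y). (x \<in> A) \<noteq> (y \<in> A)} p" by (auto simp: indicator_def)
    finally show "(\<Sum>i\<in>I. jump_kernel G \<tau> \<delta> p * indicator (?Q i) p)
        \<le> jump_kernel G \<tau> \<delta> p * indicator {(x, y). (x \<in> A) \<noteq> (y \<in> A)} p"
      by (simp add: sum_distrib_left[symmetric] mult_left_mono)
  qed
  finally show ?thesis .
qed

section \<open>The relative isoperimetric inequality\<close>

text \<open>At a small time \<open>s\<close> the moving ball is contained in \<open>ball x ((1 + \<kappa>) * s)\<close> and is the fraction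
  \<open>(\<kappa> / (1 + \<kappa>)) ^ n\<close> of it. As \<open>A\<close> nearly fills the larger ball, it fills at least half of the
  smaller one. At time \<open>T\<close> it fills at most half, so by the intermediate value theorem it fills
  exactly half at some time between.\<close>

lemma exists_half_density_ball:
  fixes A :: "'a::euclidean_space set"
  assumes A: "A \<in> sets lebesgue" and \<kappa>: "0 < \<kappa>" and T: "0 < T"
    and \<gamma>: "continuous_on {0..T} \<gamma>" "\<And>t. t \<in> {0..T} \<Longrightarrow> dist x (\<gamma> t) \<le> t"
    and e: "0 < e" and dens: "\<And>d. 0 < d \<Longrightarrow> d < e \<Longrightarrow>
        (1 - (\<kappa> / (1 + \<kappa>)) ^ DIM('a) / 2) * measure lebesgue (ball x d) < measure lebesgue (A \<inter> ball x d)"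
    and endpoint: "measure lebesgue (A \<inter> ball (\<gamma> T) (\<kappa> * T)) \<le> measure lebesgue (ball (\<gamma> T) (\<kappa> * T)) / 2"
  shows "\<exists>t. 0 < t \<and> t \<le> T \<and>
      measure lebesgue (A \<inter> ball (\<gamma> t) (\<kappa> * t)) = measure lebesgue (ball (\<gamma> t) (\<kappa> * t)) / 2"
proof -
  let ?\<mu> = "measure lebesgue :: 'a set \<Rightarrow> real"
  define s where "s = min T (e / (2 * (1 + \<kappa>)))"
  define d where "d = (1 + \<kappa>) * s"
  have s: "0 < s" "s \<le> T" using T e \<kappa> by (auto simp: s_def)
  have "d \<le> (1 + \<kappa>) * (e / (2 * (1 + \<kappa>)))"
    unfolding d_def s_def using \<kappa> by (intro mult_left_mono) auto
  also have "\<dots> = e / 2" using \<kappa> by (simp add: field_simps)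
  finally have d: "0 < d" "d < e" using s \<kappa> e by (auto simp: d_def)
  let ?B = "ball (\<gamma> s) (\<kappa> * s)"
  have sub: "?B \<subseteq> ball x d"
  proof
    fix y assume "y \<in> ?B"
    then show "y \<in> ball x d"
      using \<gamma>(2)[of s] s dist_triangle[of x y "\<gamma> s"] by (auto simp: d_def algebra_simps)
  qed
  have start: "?\<mu> ?B / 2 \<le> ?\<mu> (A \<inter> ?B)"
  proof (rule ccontr)
    assume "\<not> ?\<mu> ?B / 2 \<le> ?\<mu> (A \<inter> ?B)"
    have "?\<mu> ?B - ?\<mu> (A \<inter> ?B) = ?\<mu> (?B - A)"
      using A by (intro measure_Diff_Int[symmetric]) auto
    moreover have "?\<mu> (A \<inter> ball x d) + ?\<mu> (?B - A) = ?\<mu> ((A \<inter> ball x d) \<union> (?B - A))"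
      using A fmeasurable_Int_fmeasurable[of "ball x d" lebesgue A]
      by (intro measure_Un_AE[symmetric]) (auto simp: Int_commute intro: fmeasurable_Diff)
    moreover have "\<dots> \<le> ?\<mu> (ball x d)"
      using A sub by (intro measure_mono_fmeasurable sets.Un sets.Int sets.Diff) auto
    moreover have "?\<mu> ?B = (\<kappa> / (1 + \<kappa>)) ^ DIM('a) * ?\<mu> (ball x d)"
      using \<kappa> s d(1) by (simp add: content_ball d_def power_mult_distrib power_divide)
    moreover have "?\<mu> (ball x d) - (\<kappa> / (1 + \<kappa>)) ^ DIM('a) * ?\<mu> (ball x d) / 2 < ?\<mu> (A \<inter> ball x d)"
      using dens[OF d] by (simp add: left_diff_distrib)
    ultimately show False using \<open>\<not> ?\<mu> ?B / 2 \<le> ?\<mu> (A \<inter> ?B)\<close> by linarith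
  qed
  have "continuous_on {s..T} (\<lambda>t. ?\<mu> (A \<inter> ball (\<gamma> t) (\<kappa> * t)) - ?\<mu> (UNIV \<inter> ball (\<gamma> t) (\<kappa> * t)) / 2)"
    using s by (intro continuous_intros continuous_on_measure_Int_ball A continuous_on_subset[OF \<gamma>(1)]) auto
  from IVT2'[OF _ _ s(2) this, of 0] start endpoint
  obtain t where "s \<le> t" "t \<le> T" "?\<mu> (A \<inter> ball (\<gamma> t) (\<kappa> * t)) - ?\<mu> (ball (\<gamma> t) (\<kappa> * t)) / 2 = 0"
    by auto
  then show ?thesis using s by (intro exI[of _ t]) auto
qed

text \<open>The factor \<open>15 * c / \<tau>\<close> is the ratio of the radius \<open>5 * t\<close> of a Vitali enlarged ball to the radius
  \<open>\<tau> / (3 * c) * t\<close> of the halved ball in it; \<open>(unit_ball_vol n)\<^sup>2 / 2 powr (n + \<delta> + 2)\<close> is the constant of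
  the perimeter bound for halved balls.\<close>

definition isoperimetric_const :: "real \<Rightarrow> real \<Rightarrow> real \<Rightarrow> real \<Rightarrow> real" where
  "isoperimetric_const n c \<tau> \<delta> =
     unit_ball_vol n * (15 * c / \<tau>) powr n * (2 powr (n + \<delta> + 2) / (unit_ball_vol n)\<^sup>2) powr (n / (n - \<delta>))"

text \<open>Each single \<open>r i powr (n - \<delta>)\<close> is at most \<open>S\<close>, which bounds the factor \<open>r i powr \<delta>\<close> of
  \<open>r i powr n\<close> uniformly.\<close>

lemma sum_powr_le_powr_of_sum_bound:
  fixes r :: "'i \<Rightarrow> real"
  assumes I: "finite I" and r: "\<And>i. i \<in> I \<Longrightarrow> 0 < r i" and \<delta>: "0 < \<delta>" "\<delta> < n"
    and S: "(\<Sum>i\<in>I. r i powr (n - \<delta>)) \<le> S" and S0: "0 \<le> S"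
  shows "(\<Sum>i\<in>I. r i powr n) \<le> S powr (n / (n - \<delta>))"
proof -
  have rS: "r i powr \<delta> \<le> S powr (\<delta> / (n - \<delta>))" if i: "i \<in> I" for i
  proof -
    have "r i powr (n - \<delta>) \<le> (\<Sum>i\<in>I. r i powr (n - \<delta>))"
      using I i by (intro member_le_sum) auto
    also note S
    finally have "(r i powr (n - \<delta>)) powr (\<delta> / (n - \<delta>)) \<le> S powr (\<delta> / (n - \<delta>))"
      using \<delta> by (intro powr_mono2) auto
    then show ?thesis using \<delta> by (simp add: powr_powr)
  qed
  have "(\<Sum>i\<in>I. r i powr n) = (\<Sum>i\<in>I. r i powr \<delta> * r i powr (n - \<delta>))"
    by (intro sum.cong) (auto simp: powr_add[symmetric])
  also have "\<dots> \<le> (\<Sum>i\<in>I. S powr (\<delta> / (n - \<delta>)) * r i powr (n - \<delta>))"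
    using rS by (intro sum_mono mult_right_mono) auto
  also have "\<dots> = S powr (\<delta> / (n - \<delta>)) * (\<Sum>i\<in>I. r i powr (n - \<delta>))"
    by (simp add: sum_distrib_left)
  also have "\<dots> \<le> S powr (\<delta> / (n - \<delta>)) * S" using S by (intro mult_left_mono) auto
  also have "\<dots> = S powr (\<delta> / (n - \<delta>) + 1)"
    using S0 by (cases "S = 0") (auto simp: powr_add)
  also have "\<delta> / (n - \<delta>) + 1 = n / (n - \<delta>)" using \<delta> by (simp add: field_simps)
  finally show ?thesis .
qed

text \<open>The relative isoperimetric inequality. Almost every \<open>x \<in> A\<close> has a time \<open>t\<close> and a centre \<open>z\<close>
  with \<open>x \<in> cball z t\<close> such that \<open>A\<close> fills exactly half of \<open>ball z (\<kappa> * t)\<close>. Vitali's covering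
  lemma makes the balls \<open>cball z t\<close> disjoint while their fivefold enlargements still cover \<open>A\<close>; the
  volume of these is comparable to that of the halved balls, which the perimeter of \<open>A\<close> controls.\<close>

lemma measure_le_jump_perimeter_powr:
  fixes G A :: "'a::euclidean_space set"
  assumes \<tau>: "0 < \<tau>" "\<tau> < 1" and \<delta>: "0 < \<delta>" "\<delta> < real DIM('a)" and c: "1 \<le> c"
    and G: "open G" "bounded G" and T: "0 < T"
    and curves: "\<And>x. x \<in> G \<Longrightarrow> \<exists>\<gamma>. continuous_on {0..T} \<gamma> \<and> \<gamma> T = w \<and>
        (\<forall>t\<in>{0..T}. dist x (\<gamma> t) \<le> t \<and> infdist (\<gamma> t) (frontier G) \<ge> t / c)"
    and A: "A \<in> sets borel" "A \<subseteq> G"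
    and half: "measure lborel (A \<inter> ball w (\<tau> / (3 * c) * T)) \<le> measure lborel (ball w (\<tau> / (3 * c) * T)) / 2"
    and J: "jump_perimeter G \<tau> \<delta> A = ennreal J" "0 \<le> J"
  shows "measure lborel A \<le> isoperimetric_const (real DIM('a)) c \<tau> \<delta> * J powr (real DIM('a) / (real DIM('a) - \<delta>))"
proof -
  let ?n = "real DIM('a)"
  let ?\<omega> = "unit_ball_vol ?n"
  define \<kappa> where "\<kappa> = \<tau> / (3 * c)"
  have \<kappa>: "0 < \<kappa>" "\<kappa> < 1" using \<tau> c by (auto simp: \<kappa>_def field_simps)
  define p where "p = 1 - (\<kappa> / (1 + \<kappa>)) ^ DIM('a) / 2"
  have "(\<kappa> / (1 + \<kappa>)) ^ DIM('a) \<le> 1" using \<kappa> by (intro power_le_one) auto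
  then have p: "0 \<le> p" "p < 1" using \<kappa> by (auto simp: p_def)
  have Abd: "bounded A" using A(2) G(2) by (rule bounded_subset[rotated])
  have Al: "A \<in> lmeasurable" using A(1) Abd by (intro bounded_set_imp_lmeasurable) auto
  \<comment> \<open>Outside \<open>N\<close> the set \<open>A\<close> nearly fills all small balls around \<open>x\<close>, as the moving ball needs at its start.\<close>
  define N where "N = {x \<in> A. \<forall>e>0. \<exists>d. 0 < d \<and> d < e \<and>
           measure lebesgue (A \<inter> ball x d) \<le> p * measure lebesgue (ball x d)}"
  have N: "negligible N" unfolding N_def by (rule negligible_low_density_points[OF Al p])
  have "\<exists>t z. 0 < t \<and> t \<le> T \<and> dist x z \<le> t \<and> \<kappa> * t \<le> \<tau> / 3 * infdist z (frontier G) \<and>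
      measure lebesgue (A \<inter> ball z (\<kappa> * t)) = measure lebesgue (ball z (\<kappa> * t)) / 2"
    if x: "x \<in> A - N" for x
  proof -
    from curves[of x] x A(2) obtain \<gamma> where \<gamma>: "continuous_on {0..T} \<gamma>" "\<gamma> T = w"
      "\<And>t. t \<in> {0..T} \<Longrightarrow> dist x (\<gamma> t) \<le> t"
      "\<And>t. t \<in> {0..T} \<Longrightarrow> infdist (\<gamma> t) (frontier G) \<ge> t / c" by blast
    from x obtain e where e: "e > 0" "\<And>d. 0 < d \<Longrightarrow> d < e \<Longrightarrow>
       p * measure lebesgue (ball x d) < measure lebesgue (A \<inter> ball x d)"
      unfolding N_def by (auto simp: not_le)
    have "\<exists>t. 0 < t \<and> t \<le> T \<and>
        measure lebesgue (A \<inter> ball (\<gamma> t) (\<kappa> * t)) = measure lebesgue (ball (\<gamma> t) (\<kappa> * t)) / 2"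
      by (rule exists_half_density_ball[OF _ \<kappa>(1) T \<gamma>(1,3) e(1)])
        (use Al e(2) half A(1) in \<open>auto simp: p_def \<gamma>(2) \<kappa>_def fmeasurableD\<close>)
    then obtain t where t: "0 < t" "t \<le> T"
      "measure lebesgue (A \<inter> ball (\<gamma> t) (\<kappa> * t)) = measure lebesgue (ball (\<gamma> t) (\<kappa> * t)) / 2" by blast
    have "\<tau> / 3 * (t / c) \<le> \<tau> / 3 * infdist (\<gamma> t) (frontier G)"
      using \<gamma>(4)[of t] t \<tau> by (intro mult_left_mono) auto
    then show ?thesis using \<gamma>(3)[of t] t by (intro exI[of _ t] exI[of _ "\<gamma> t"]) (auto simp: \<kappa>_def)
  qed
  then obtain t z where tz: "\<And>x. x \<in> A - N \<Longrightarrow> 0 < t x \<and> t x \<le> T \<and> dist x (z x) \<le> t x \<and>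
      \<kappa> * t x \<le> \<tau> / 3 * infdist (z x) (frontier G) \<and>
      measure lebesgue (A \<inter> ball (z x) (\<kappa> * t x)) = measure lebesgue (ball (z x) (\<kappa> * t x)) / 2"
    by metis
  obtain C where C: "countable C" "C \<subseteq> A - N"
     "pairwise (\<lambda>i j. disjnt (cball (z i) (t i)) (cball (z j) (t j))) C"
     "A - N \<subseteq> (\<Union>i\<in>C. cball (z i) (5 * t i))"
  proof (rule Vitali_covering_lemma_cballs[where S="A - N" and K="A - N" and a=z and r=t and B=T])
    show "A - N \<subseteq> (\<Union>i\<in>A - N. cball (z i) (t i))" using tz by (force simp: dist_commute)
  qed (use tz in auto)
  define B where "B = isoperimetric_const ?n c \<tau> \<delta> * J powr (?n / (?n - \<delta>))"
  define a where "a = ?\<omega>\<^sup>2 / 2 powr (?n + \<delta> + 2)"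
  have \<omega>: "?\<omega> > 0" by simp
  then have a: "a > 0" unfolding a_def by (intro divide_pos_pos zero_less_power) auto
  have bound: "(\<Sum>i\<in>I. measure lborel (cball (z i) (5 * t i))) \<le> B" if I: "I \<subseteq> C" "finite I" for I
  proof -
    have tI: "0 < t i" if "i \<in> I" for i using tz that I C by blast
    have disj: "disjoint_family_on (\<lambda>i. ball (z i) (\<kappa> * t i)) I"
      unfolding disjoint_family_on_def
    proof (intro ballI impI)
      fix i j assume ij: "i \<in> I" "j \<in> I" "i \<noteq> j"
      have "ball (z k) (\<kappa> * t k) \<subseteq> cball (z k) (t k)" if "k \<in> I" for k
      proof -
        have "\<kappa> * t k \<le> t k" using tI[OF that] \<kappa> by (intro mult_left_le_one_le) auto
        then show ?thesis using ball_subset_cball by fastforce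
      qed
      moreover have "cball (z i) (t i) \<inter> cball (z j) (t j) = {}"
        using C(3) ij I(1) by (auto simp: pairwise_def disjnt_def)
      ultimately show "ball (z i) (\<kappa> * t i) \<inter> ball (z j) (\<kappa> * t j) = {}" using ij by blast
    qed
    have "(\<Sum>i\<in>I. ennreal (?\<omega>\<^sup>2 / 2 powr (?n + \<delta> + 2) * (\<kappa> * t i) powr (?n - \<delta>)))
       \<le> jump_perimeter G \<tau> \<delta> A"
      by (rule sum_halved_balls_le_jump_perimeter[OF \<tau> \<delta>(1) _ A(1) A(2) I(2) disj])
        (use G(1) tz I(1) C(2) \<kappa>(1) A(1) in \<open>auto simp: subset_iff\<close>)
    then have "(\<Sum>i\<in>I. ennreal (a * (\<kappa> * t i) powr (?n - \<delta>))) \<le> ennreal J"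
      by (simp add: a_def J)
    then have "(\<Sum>i\<in>I. a * (\<kappa> * t i) powr (?n - \<delta>)) \<le> J"
      using a J by (simp add: sum_ennreal ennreal_le_iff)
    then have "a * (\<Sum>i\<in>I. (\<kappa> * t i) powr (?n - \<delta>)) \<le> J" by (simp add: sum_distrib_left)
    then have "(\<Sum>i\<in>I. (\<kappa> * t i) powr (?n - \<delta>)) \<le> J / a" using a by (simp add: field_simps)
    then have "(\<Sum>i\<in>I. (\<kappa> * t i) powr ?n) \<le> (J / a) powr (?n / (?n - \<delta>))"
      using \<delta> \<kappa> tI a J by (intro sum_powr_le_powr_of_sum_bound I) auto
    also have "\<dots> = (1 / a) powr (?n / (?n - \<delta>)) * J powr (?n / (?n - \<delta>))"
      using a J by (simp add: powr_mult[symmetric])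
    finally have "?\<omega> * (5 / \<kappa>) powr ?n * (\<Sum>i\<in>I. (\<kappa> * t i) powr ?n)
       \<le> ?\<omega> * (5 / \<kappa>) powr ?n * ((1 / a) powr (?n / (?n - \<delta>)) * J powr (?n / (?n - \<delta>)))"
      by (intro mult_left_mono) auto
    also have "\<dots> = B" using c \<tau> by (simp add: B_def isoperimetric_const_def a_def \<kappa>_def mult.assoc)
    also have "?\<omega> * (5 / \<kappa>) powr ?n * (\<Sum>i\<in>I. (\<kappa> * t i) powr ?n)
       = (\<Sum>i\<in>I. measure lborel (cball (z i) (5 * t i)))"
      unfolding sum_distrib_left
    proof (rule sum.cong[OF refl])
      fix i assume "i \<in> I"
      have "?\<omega> * (5 / \<kappa>) powr ?n * (\<kappa> * t i) powr ?n = ?\<omega> * ((5 / \<kappa>) * (\<kappa> * t i)) powr ?n"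
        using \<kappa> tI[OF \<open>i \<in> I\<close>] by (subst powr_mult) auto
      also have "(5 / \<kappa>) * (\<kappa> * t i) = 5 * t i" using \<kappa> by simp
      also have "?\<omega> * (5 * t i) powr ?n = measure lborel (cball (z i) (5 * t i))"
        using tI[OF \<open>i \<in> I\<close>] by (simp add: content_cball powr_realpow)
      finally show "?\<omega> * (5 / \<kappa>) powr ?n * (\<kappa> * t i) powr ?n = measure lborel (cball (z i) (5 * t i))" .
    qed
    finally show ?thesis .
  qed
  let ?U = "\<Union>i\<in>C. cball (z i) (5 * t i)"
  have U: "?U \<in> lmeasurable \<and> measure lebesgue ?U \<le> B"
  proof -
    have "measure lebesgue (\<Union>i\<in>I. cball (z i) (5 * t i)) \<le> B" if I: "I \<subseteq> C" "finite I" for I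
      using measure_UNION_le[of I "\<lambda>i. cball (z i) (5 * t i)" lebesgue] bound[OF I] I by simp
    then show ?thesis
      using fmeasurable_UN_bound[OF C(1), of "\<lambda>i. cball (z i) (5 * t i)" lebesgue B]
        measure_UN_bound[OF C(1), of "\<lambda>i. cball (z i) (5 * t i)" lebesgue B] by simp
  qed
  have "measure lebesgue A = measure lebesgue (A - N)"
    using N Al by (simp add: measure_Diff_null_set negligible_iff_null_sets fmeasurableD)
  also have "\<dots> \<le> measure lebesgue ?U"
  proof (rule measure_mono_fmeasurable[OF C(4)])
    show "A - N \<in> sets lebesgue"
      using N Al by (intro sets.Diff) (auto simp: negligible_iff_null_sets fmeasurableD)
  qed (use U in blast)
  also have "\<dots> \<le> B" using U by blast
  finally show ?thesis using A(1) by (simp add: B_def)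
qed

section \<open>Integrals of powers\<close>

lemma Youngs_inequality_powr:
  fixes a b q :: real
  assumes q: "1 < q" and "0 \<le> a" "0 \<le> b"
  shows "a powr (q - 1) * b \<le> (1 - 1/q) * a powr q + b powr q / q"
proof -
  have "a powr (q-1) * b \<le> (a powr (q-1)) powr (q/(q-1)) / (q/(q-1)) + b powr q / q"
    by (rule Youngs_inequality) (use assms in \<open>auto simp: field_simps\<close>)
  also have "(a powr (q-1)) powr (q/(q-1)) = a powr q" using q by (simp add: powr_powr)
  finally show ?thesis using q by (simp add: field_simps)
qed

text \<open>Minkowski's inequality in \<open>L\<^sup>q\<close> for the layer cake decomposition of \<open>v\<close>. Let \<open>X\<close> be the integral of
  \<open>v powr q\<close>. Writing \<open>v powr q = v powr (q - 1) * v\<close> and the last factor as the integral of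
  the indicators of \<open>s < v x\<close>, Fubini and the Hoelder inequality on each superlevel set give
  \<open>X \<le> \<Phi> * X powr (1 - 1/q)\<close>. Boundedness of \<open>v\<close> makes \<open>X\<close> finite, so that it can be divided out.\<close>

lemma nn_integral_powr_le_superlevel_integral_bounded:
  fixes v :: "'a \<Rightarrow> real"
  assumes M: "sigma_finite_measure M" and v[measurable]: "v \<in> borel_measurable M"
    and v0: "\<And>x. 0 \<le> v x" and vK: "\<And>x. v x \<le> K"
    and fin: "emeasure M {x \<in> space M. 0 < v x} < \<infinity>" and q: "1 < q" and \<Phi>: "0 \<le> \<Phi>"
    and le: "(\<integral>\<^sup>+s\<in>{0<..}. ennreal (measure M {x \<in> space M. s < v x} powr (1/q)) \<partial>lborel) \<le> ennreal \<Phi>"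
  shows "(\<integral>\<^sup>+x. ennreal (v x powr q) \<partial>M) \<le> ennreal (\<Phi> powr q)"
proof -
  interpret sigma_finite_measure M by fact
  interpret P: pair_sigma_finite M lborel by unfold_locales
  have "(\<integral>\<^sup>+x. ennreal (v x powr q) \<partial>M) \<le> (\<integral>\<^sup>+x. ennreal (K powr q) * indicator {x \<in> space M. 0 < v x} x \<partial>M)"
  proof (intro nn_integral_mono)
    fix x assume "x \<in> space M"
    then show "ennreal (v x powr q) \<le> ennreal (K powr q) * indicator {x \<in> space M. 0 < v x} x"
      using v0[of x] vK[of x] q by (cases "v x = 0") (auto intro!: ennreal_leI powr_mono2)
  qed
  also have "\<dots> = ennreal (K powr q) * emeasure M {x \<in> space M. 0 < v x}"
    by (rule nn_integral_cmult_indicator) measurable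
  also have "\<dots> < \<infinity>" using fin by (simp add: ennreal_mult_less_top)
  finally obtain X where X: "0 \<le> X" "(\<integral>\<^sup>+x. ennreal (v x powr q) \<partial>M) = ennreal X"
    by (metis ennreal_cases infinity_ennreal_def less_irrefl)
  let ?\<sigma> = "\<lambda>s. measure M {x \<in> space M. s < v x}"
  have em: "emeasure M {x \<in> space M. s < v x} = ennreal (?\<sigma> s)" if "0 < s" for s
  proof -
    have "emeasure M {x \<in> space M. s < v x} \<le> emeasure M {x \<in> space M. 0 < v x}"
      using that by (intro emeasure_mono) auto
    with fin show ?thesis by (intro emeasure_eq_ennreal_measure) (auto simp: top_unique)
  qed
  have [measurable]: "?\<sigma> \<in> borel_measurable borel"
    unfolding measure_def by measurable
  show ?thesis
  proof (cases "X = 0")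
    case True then show ?thesis by (simp add: X)
  next
    case False
    then have X0: "X > 0" using X by simp
    have inner: "(\<integral>\<^sup>+x. (if 0 < s \<and> s < v x then ennreal (v x powr (q-1)) else 0) \<partial>M)
        \<le> ennreal (X powr (1-1/q)) * (ennreal (?\<sigma> s powr (1/q)) * indicator {0<..} s)" for s
    proof (cases "0 < s")
      case False then show ?thesis by simp
    next
      case s: True
      show ?thesis
      proof (cases "?\<sigma> s = 0")
        case True
        then have "AE x in M. \<not> s < v x"
          using em[OF s] by (subst AE_iff_null) (auto simp: null_sets_def)
        then have "(\<integral>\<^sup>+x. (if 0 < s \<and> s < v x then ennreal (v x powr (q-1)) else 0) \<partial>M) = (\<integral>\<^sup>+x. 0 \<partial>M)"
          by (intro nn_integral_cong_AE) auto
        then show ?thesis by simp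
      next
        case False
        then have \<sigma>: "?\<sigma> s > 0" by (simp add: zero_less_measure_iff)
        \<comment> \<open>Hoelder from Young's inequality; this \<open>l\<close> balances the two terms.\<close>
        define l where "l = (X / ?\<sigma> s) powr (1/q)"
        have l: "l > 0" using X0 \<sigma> by (simp add: l_def)
        have pt: "v x powr (q-1) \<le> (1-1/q)/l * v x powr q + l powr (q-1) / q" for x
        proof -
          have "v x powr (q-1) * l \<le> (1-1/q) * v x powr q + l powr q / q"
            by (rule Youngs_inequality_powr) (use q v0 l in auto)
          also have "l powr q = l powr (q-1) * l" using l by (simp add: powr_diff)
          finally show ?thesis using l by (simp add: field_simps)
        qed
        have "(\<integral>\<^sup>+x. (if 0 < s \<and> s < v x then ennreal (v x powr (q-1)) else 0) \<partial>M)
           \<le> (\<integral>\<^sup>+x. ennreal ((1-1/q)/l) * ennreal (v x powr q)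
                 + ennreal (l powr (q-1) / q) * indicator {x \<in> space M. s < v x} x \<partial>M)"
        proof (intro nn_integral_mono)
          fix x assume "x \<in> space M"
          then show "(if 0 < s \<and> s < v x then ennreal (v x powr (q-1)) else 0)
            \<le> ennreal ((1-1/q)/l) * ennreal (v x powr q)
                 + ennreal (l powr (q-1) / q) * indicator {x \<in> space M. s < v x} x"
            using pt[of x] q l
            by (auto simp: ennreal_mult[symmetric] ennreal_plus[symmetric] simp del: ennreal_plus intro!: ennreal_leI)
        qed
        also have "\<dots> = ennreal ((1-1/q)/l) * ennreal X + ennreal (l powr (q-1) / q) * ennreal (?\<sigma> s)"
          by (simp add: nn_integral_add nn_integral_cmult X(2) em[OF s])
        also have "\<dots> = ennreal ((1-1/q)/l * X + l powr (q-1) / q * ?\<sigma> s)"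
          using q l X \<sigma> by (simp add: ennreal_mult[symmetric] ennreal_plus[symmetric] del: ennreal_plus)
        also have "(1-1/q)/l * X + l powr (q-1) / q * ?\<sigma> s = X powr (1-1/q) * ?\<sigma> s powr (1/q)"
        proof -
          have 1: "X / l = X powr (1-1/q) * ?\<sigma> s powr (1/q)"
            using X0 \<sigma> by (simp add: l_def powr_divide powr_diff)
          have "l powr (q-1) = (X / ?\<sigma> s) powr (1 - 1/q)"
            using q by (simp add: l_def powr_powr diff_divide_distrib)
          then have 2: "l powr (q-1) * ?\<sigma> s = X powr (1-1/q) * ?\<sigma> s powr (1/q)"
            using X0 \<sigma> by (simp add: powr_divide powr_diff)
          have "(1-1/q)/l * X + l powr (q-1) / q * ?\<sigma> s = (1-1/q) * (X / l) + (l powr (q-1) * ?\<sigma> s) / q"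
            by simp
          also have "\<dots> = X powr (1-1/q) * ?\<sigma> s powr (1/q)"
            unfolding 1 2 by (simp add: algebra_simps)
          finally show ?thesis .
        qed
        finally show ?thesis using s by (simp add: ennreal_mult)
      qed
    qed
    have cake: "ennreal (v x powr q) = (\<integral>\<^sup>+s. (if 0 < s \<and> s < v x then ennreal (v x powr (q-1)) else 0) \<partial>lborel)" for x
    proof -
      have "(\<integral>\<^sup>+s. (if 0 < s \<and> s < v x then ennreal (v x powr (q-1)) else 0) \<partial>lborel)
          = (\<integral>\<^sup>+s. ennreal (v x powr (q-1)) * indicator {0<..<v x} s \<partial>lborel)"
        by (intro nn_integral_cong) auto
      also have "\<dots> = ennreal (v x powr (q-1)) * ennreal (v x)"
        using v0[of x] by (subst nn_integral_cmult_indicator) auto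
      also have "\<dots> = ennreal (v x powr q)"
        using v0[of x] by (cases "v x = 0") (auto simp: ennreal_mult[symmetric] powr_diff)
      finally show ?thesis ..
    qed
    have "ennreal X = (\<integral>\<^sup>+x. \<integral>\<^sup>+s. (if 0 < s \<and> s < v x then ennreal (v x powr (q-1)) else 0) \<partial>lborel \<partial>M)"
      unfolding X(2)[symmetric] by (intro nn_integral_cong cake)
    also have "\<dots> = (\<integral>\<^sup>+s. \<integral>\<^sup>+x. (if 0 < s \<and> s < v x then ennreal (v x powr (q-1)) else 0) \<partial>M \<partial>lborel)"
      by (rule P.Fubini'[symmetric]) measurable
    also have "\<dots> \<le> (\<integral>\<^sup>+s. ennreal (X powr (1-1/q)) * (ennreal (?\<sigma> s powr (1/q)) * indicator {0<..} s) \<partial>lborel)"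
      by (intro nn_integral_mono inner)
    also have "\<dots> = ennreal (X powr (1-1/q)) * (\<integral>\<^sup>+s\<in>{0<..}. ennreal (?\<sigma> s powr (1/q)) \<partial>lborel)"
      by (rule nn_integral_cmult) measurable
    also have "\<dots> \<le> ennreal (X powr (1-1/q)) * ennreal \<Phi>" using le by (rule mult_left_mono) simp
    finally have "X \<le> X powr (1-1/q) * \<Phi>"
      using \<Phi> by (simp add: ennreal_mult[symmetric] ennreal_le_iff)
    then have "X powr (1/q) \<le> \<Phi>" using X0 by (simp add: powr_diff field_simps)
    then have "(X powr (1/q)) powr q \<le> \<Phi> powr q" using q by (intro powr_mono2) auto
    then show ?thesis using X q X0 by (simp add: powr_powr ennreal_leI)
  qed
qed

lemma nn_integral_powr_le_superlevel_integral:
  fixes v :: "'a \<Rightarrow> real"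
  assumes M: "sigma_finite_measure M" and v[measurable]: "v \<in> borel_measurable M"
    and v0: "\<And>x. 0 \<le> v x"
    and fin: "emeasure M {x \<in> space M. 0 < v x} < \<infinity>" and q: "1 < q" and \<Phi>: "0 \<le> \<Phi>"
    and le: "(\<integral>\<^sup>+s\<in>{0<..}. ennreal (measure M {x \<in> space M. s < v x} powr (1/q)) \<partial>lborel) \<le> ennreal \<Phi>"
  shows "(\<integral>\<^sup>+x. ennreal (v x powr q) \<partial>M) \<le> ennreal (\<Phi> powr q)"
proof -
  let ?v = "\<lambda>k x. min (v x) (real k)"
  have fin': "emeasure M {x \<in> space M. s < v x} < \<infinity>" if "0 < s" for s
  proof -
    have "emeasure M {x \<in> space M. s < v x} \<le> emeasure M {x \<in> space M. 0 < v x}"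
      using that by (intro emeasure_mono) auto
    with fin show ?thesis by (rule le_less_trans[rotated])
  qed
  have bd: "(\<integral>\<^sup>+x. ennreal (?v k x powr q) \<partial>M) \<le> ennreal (\<Phi> powr q)" for k
  proof (rule nn_integral_powr_le_superlevel_integral_bounded[OF M _ _ _ _ q \<Phi>, of _ "real k"])
    have "emeasure M {x \<in> space M. 0 < ?v k x} \<le> emeasure M {x \<in> space M. 0 < v x}"
      by (intro emeasure_mono) auto
    with fin show "emeasure M {x \<in> space M. 0 < ?v k x} < \<infinity>" by (rule le_less_trans[rotated])
    have "(\<integral>\<^sup>+s\<in>{0<..}. ennreal (measure M {x \<in> space M. s < ?v k x} powr (1/q)) \<partial>lborel)
       \<le> (\<integral>\<^sup>+s\<in>{0<..}. ennreal (measure M {x \<in> space M. s < v x} powr (1/q)) \<partial>lborel)"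
      using q fin'
      by (intro nn_integral_mono) (auto simp: indicator_def fmeasurable_def intro!: ennreal_leI powr_mono2 measure_mono_fmeasurable)
    also note le
    finally show "(\<integral>\<^sup>+s\<in>{0<..}. ennreal (measure M {x \<in> space M. s < ?v k x} powr (1/q)) \<partial>lborel) \<le> ennreal \<Phi>" .
  qed (use v0 in auto)
  have sup: "ennreal (v x powr q) = (SUP k. ennreal (?v k x powr q))" for x
  proof (rule antisym)
    obtain k where "v x \<le> real k" using real_arch_simple by blast
    then show "ennreal (v x powr q) \<le> (SUP k. ennreal (?v k x powr q))"
      by (intro SUP_upper2[of k]) (auto simp: min_absorb1)
    show "(SUP k. ennreal (?v k x powr q)) \<le> ennreal (v x powr q)"
      using q v0 by (intro SUP_least ennreal_leI powr_mono2) auto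
  qed
  have "(\<integral>\<^sup>+x. ennreal (v x powr q) \<partial>M) = (SUP k. \<integral>\<^sup>+x. ennreal (?v k x powr q) \<partial>M)"
    unfolding sup
  proof (rule nn_integral_monotone_convergence_SUP)
    show "incseq (\<lambda>k x. ennreal (?v k x powr q))"
      using q v0 by (intro incseq_SucI le_funI ennreal_leI powr_mono2) auto
  qed measurable
  also have "\<dots> \<le> ennreal (\<Phi> powr q)" using bd by (rule SUP_least)
  finally show ?thesis .
qed

text \<open>By Jensen's inequality the distance \<open>d\<close> from \<open>m\<close> to the average satisfies
  \<open>d powr q * measure M G \<le> X\<close>, where \<open>X\<close> is the integral on the right. Here Jensen comes from
  integrating Young's inequality for \<open>d powr (q - 1) * \<bar>u x - m\<bar>\<close>.\<close>

lemma nn_integral_powr_deviation_average_le: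
  fixes u :: "'a \<Rightarrow> real" and m q :: real
  assumes G[measurable]: "G \<in> sets M" and fin: "emeasure M G < \<infinity>" and pos: "0 < measure M G"
    and u: "set_integrable M G u" and q: "1 < q"
  defines "a \<equiv> (LINT x:G|M. u x) / measure M G"
  shows "(\<integral>\<^sup>+x\<in>G. ennreal (\<bar>u x - a\<bar> powr q) \<partial>M)
      \<le> ennreal (2 powr (q+1)) * (\<integral>\<^sup>+x\<in>G. ennreal (\<bar>u x - m\<bar> powr q) \<partial>M)"
proof -
  \<comment> \<open>Only the restriction of \<open>u\<close> to \<open>G\<close> is known to be measurable; it is extended by zero.\<close>
  define w where "w x = indicator G x * u x" for x
  define g where "g = measure M G"
  have eG: "emeasure M G = ennreal g"
    using fin by (simp add: g_def emeasure_eq_ennreal_measure less_top)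
  have g: "g > 0" using pos by (simp add: g_def)
  have wi: "integrable M w" using u by (simp add: set_integrable_def w_def[abs_def])
  then have [measurable]: "w \<in> borel_measurable M" by auto
  have uw: "(\<integral>\<^sup>+x\<in>G. ennreal (\<bar>u x - b\<bar> powr q) \<partial>M) = (\<integral>\<^sup>+x\<in>G. ennreal (\<bar>w x - b\<bar> powr q) \<partial>M)" for b
    by (intro nn_integral_cong) (auto simp: w_def indicator_def)
  have a: "a * g = (\<integral>x. w x \<partial>M)"
    using g by (simp add: a_def set_lebesgue_integral_def w_def[abs_def] g_def)
  have Gi: "integrable M (indicator G :: 'a \<Rightarrow> real)"
    using fin by (intro integrable_real_indicator) auto
  define d where "d = \<bar>a - m\<bar>"
  have "(a - m) * g = (\<integral>x. w x - m * indicator G x \<partial>M)"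
    using a wi Gi fin by (simp add: algebra_simps g_def)
  then have "d * g = norm (\<integral>x. w x - m * indicator G x \<partial>M)"
    using g by (metis abs_mult abs_of_pos d_def real_norm_def)
  then have "ennreal (d * g) \<le> (\<integral>\<^sup>+x. norm (w x - m * indicator G x) \<partial>M)"
    using integral_norm_bound_ennreal[of M "\<lambda>x. w x - m * indicator G x"] wi Gi
    by (metis Bochner_Integration.integrable_diff integrable_mult_right)
  also have "\<dots> = (\<integral>\<^sup>+x\<in>G. ennreal \<bar>w x - m\<bar> \<partial>M)"
    by (intro nn_integral_cong) (auto simp: w_def indicator_def)
  finally have dg: "ennreal (d * g) \<le> (\<integral>\<^sup>+x\<in>G. ennreal \<bar>w x - m\<bar> \<partial>M)" .
  show ?thesis unfolding uw
  proof (cases "(\<integral>\<^sup>+x\<in>G. ennreal (\<bar>w x - m\<bar> powr q) \<partial>M)")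
    case top
    then show "(\<integral>\<^sup>+x\<in>G. ennreal (\<bar>w x - a\<bar> powr q) \<partial>M)
      \<le> ennreal (2 powr (q+1)) * (\<integral>\<^sup>+x\<in>G. ennreal (\<bar>w x - m\<bar> powr q) \<partial>M)"
      by (simp add: ennreal_mult_top)
  next
    case (real X)
    have d0: "d \<ge> 0" by (simp add: d_def)
    have "ennreal (d powr (q-1) * (d * g)) \<le> ennreal (d powr (q-1)) * (\<integral>\<^sup>+x\<in>G. ennreal \<bar>w x - m\<bar> \<partial>M)"
      using dg d0 g by (simp add: ennreal_mult mult_left_mono)
    also have "\<dots> = (\<integral>\<^sup>+x. ennreal (d powr (q-1)) * (ennreal \<bar>w x - m\<bar> * indicator G x) \<partial>M)"
      by (rule nn_integral_cmult[symmetric]) measurable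
    also have "\<dots> \<le> (\<integral>\<^sup>+x. ennreal ((1-1/q) * d powr q) * indicator G x
        + ennreal (1/q) * (ennreal (\<bar>w x - m\<bar> powr q) * indicator G x) \<partial>M)"
    proof (intro nn_integral_mono)
      fix x
      show "ennreal (d powr (q-1)) * (ennreal \<bar>w x - m\<bar> * indicator G x)
        \<le> ennreal ((1-1/q) * d powr q) * indicator G x
        + ennreal (1/q) * (ennreal (\<bar>w x - m\<bar> powr q) * indicator G x)"
        using Youngs_inequality_powr[OF q d0, of "\<bar>w x - m\<bar>"] q
        by (auto simp: indicator_def ennreal_mult[symmetric] ennreal_plus[symmetric] simp del: ennreal_plus intro!: ennreal_leI)
    qed
    also have "\<dots> = ennreal ((1-1/q) * d powr q) * ennreal g + ennreal (1/q) * ennreal X"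
      by (simp add: nn_integral_add nn_integral_cmult real eG)
    also have "\<dots> = ennreal ((1-1/q) * d powr q * g + X / q)"
      using q g real by (simp add: ennreal_mult[symmetric] ennreal_plus[symmetric] del: ennreal_plus)
    finally have "d powr (q-1) * (d * g) \<le> (1-1/q) * d powr q * g + X / q"
      using q g real by (subst (asm) ennreal_le_iff) auto
    moreover have "d powr (q-1) * (d * g) = d powr q * g"
      using d0 q by (cases "d = 0") (auto simp: powr_diff field_simps)
    ultimately have "d powr q * g \<le> (1-1/q) * (d powr q * g) + X / q" by simp
    then have "d powr q * g / q \<le> X / q" by (simp add: left_diff_distrib)
    then have dX: "d powr q * g \<le> X" using q by (simp add: divide_le_cancel)
    have pt: "\<bar>w x - a\<bar> powr q \<le> 2 powr q * \<bar>w x - m\<bar> powr q + 2 powr q * d powr q" for x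
    proof -
      have "\<bar>w x - a\<bar> powr q \<le> (2 * max \<bar>w x - m\<bar> d) powr q"
        using q by (intro powr_mono2) (auto simp: d_def max_def abs_if)
      also have "\<dots> = 2 powr q * max \<bar>w x - m\<bar> d powr q" using d0 by (simp add: powr_mult)
      also have "\<dots> \<le> 2 powr q * (\<bar>w x - m\<bar> powr q + d powr q)"
        by (intro mult_left_mono) (auto simp: max_def)
      finally show ?thesis by (simp add: algebra_simps)
    qed
    have "(\<integral>\<^sup>+x\<in>G. ennreal (\<bar>w x - a\<bar> powr q) \<partial>M)
      \<le> (\<integral>\<^sup>+x. ennreal (2 powr q) * (ennreal (\<bar>w x - m\<bar> powr q) * indicator G x)
           + ennreal (2 powr q * d powr q) * indicator G x \<partial>M)"
      using pt by (intro nn_integral_mono)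
        (auto simp: indicator_def ennreal_mult[symmetric] ennreal_plus[symmetric] simp del: ennreal_plus intro!: ennreal_leI)
    also have "\<dots> = ennreal (2 powr q) * ennreal X + ennreal (2 powr q * d powr q) * ennreal g"
      by (simp add: nn_integral_add nn_integral_cmult real eG)
    also have "\<dots> = ennreal (2 powr q * X + 2 powr q * (d powr q * g))"
      using g real by (simp add: ennreal_mult[symmetric] ennreal_plus[symmetric] mult.assoc del: ennreal_plus)
    also have "\<dots> \<le> ennreal (2 powr q * X + 2 powr q * X)"
      using dX by (intro ennreal_leI add_left_mono mult_left_mono) auto
    also have "\<dots> = ennreal (2 powr (q+1)) * ennreal X"
      using real by (simp add: ennreal_mult[symmetric] powr_add)
    finally show "(\<integral>\<^sup>+x\<in>G. ennreal (\<bar>w x - a\<bar> powr q) \<partial>M)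
      \<le> ennreal (2 powr (q+1)) * (\<integral>\<^sup>+x\<in>G. ennreal (\<bar>w x - m\<bar> powr q) \<partial>M)" by (simp add: real)
  qed
qed

section \<open>Medians\<close>

text \<open>If \<open>B\<close> has positive measure, the infimum \<open>m\<close> of the levels \<open>t\<close> with \<open>measure M {x \<in> B. t < u x} \<le> measure M B / 2\<close> is a
  median, by continuity of the measure from below on both sides of \<open>m\<close>.\<close>

lemma median_exists:
  fixes u :: "'a \<Rightarrow> real"
  assumes B: "B \<in> fmeasurable M" and u[measurable]: "u \<in> borel_measurable M"
  shows "\<exists>m. measure M {x \<in> B. m < u x} \<le> measure M B / 2 \<and> measure M {x \<in> B. u x < m} \<le> measure M B / 2"
proof -
  have Bs[measurable]: "B \<in> sets M" using B by auto
  have sets: "{x \<in> B. P x} \<in> sets M" if "Measurable.pred M P" for P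
  proof -
    have "{x \<in> B. P x} = B \<inter> {x \<in> space M. P x}" using sets.sets_into_space[OF Bs] by auto
    then show ?thesis using that Bs by (simp add: pred_def)
  qed
  have gt: "{x \<in> B. t < u x} \<in> sets M" and lt: "{x \<in> B. u x < t} \<in> sets M"
    and le: "{x \<in> B. u x \<le> t} \<in> sets M" for t
    by (intro sets; measurable)+
  have fin: "emeasure M {x \<in> B. P x} < \<infinity>" for P
  proof -
    have "emeasure M {x \<in> B. P x} \<le> emeasure M B" by (intro emeasure_mono) auto
    also have "\<dots> < \<infinity>" using B by (simp add: fmeasurable_def)
    finally show ?thesis .
  qed
  have mono: "measure M {x \<in> B. P x} \<le> measure M {x \<in> B. Q x}"
    if "\<And>x. P x \<Longrightarrow> Q x" "{x \<in> B. P x} \<in> sets M" "{x \<in> B. Q x} \<in> sets M" for P Q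
    using that fin by (intro measure_mono_fmeasurable) (auto simp: fmeasurable_def)
  have split: "measure M {x \<in> B. u x \<le> t} = measure M B - measure M {x \<in> B. t < u x}" for t
  proof -
    have "{x \<in> B. u x \<le> t} = B - {x \<in> B. t < u x}" by auto
    moreover have "measure M (B - {x \<in> B. t < u x}) = measure M B - measure M {x \<in> B. t < u x}"
      by (rule measurable_measure_Diff[OF B gt]) auto
    ultimately show ?thesis by simp
  qed
  have from_below: "measure M {x \<in> B. P x} \<le> b"
    if "\<And>k. {x \<in> B. Q k x} \<in> sets M" "\<And>k x. Q k x \<Longrightarrow> Q (Suc k) x"
      "\<And>x. P x \<longleftrightarrow> (\<exists>k. Q k x)" "\<And>k. measure M {x \<in> B. Q k x} \<le> b" for P b and Q :: "nat \<Rightarrow> 'a \<Rightarrow> bool"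
  proof -
    have eq: "(\<Union>k. {x \<in> B. Q k x}) = {x \<in> B. P x}" using that(3) by auto
    have "(\<lambda>k. measure M {x \<in> B. Q k x}) \<longlonglongrightarrow> measure M (\<Union>k. {x \<in> B. Q k x})"
    proof (rule Lim_measure_incseq)
      show "incseq (\<lambda>k. {x \<in> B. Q k x})" using that(2) by (intro incseq_SucI) auto
      show "emeasure M (\<Union>k. {x \<in> B. Q k x}) \<noteq> \<infinity>" unfolding eq using fin[of P] by simp
    qed (use that(1) in auto)
    then show ?thesis unfolding eq by (rule LIMSEQ_le_const2) (use that(4) in auto)
  qed
  have to_empty: "\<exists>k. measure M {x \<in> B. Q k x} < b"
    if "\<And>k. {x \<in> B. Q k x} \<in> sets M" "\<And>k x. Q (Suc k) x \<Longrightarrow> Q k x" "\<And>x. \<exists>k. \<not> Q k x" "0 < b"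
    for b and Q :: "nat \<Rightarrow> 'a \<Rightarrow> bool"
  proof -
    have eq: "(\<Inter>k. {x \<in> B. Q k x}) = {}" using that(3) by blast
    have "(\<lambda>k. measure M {x \<in> B. Q k x}) \<longlonglongrightarrow> measure M (\<Inter>k. {x \<in> B. Q k x})"
    proof (rule Lim_measure_decseq)
      show "decseq (\<lambda>k. {x \<in> B. Q k x})" using that(2) by (intro decseq_SucI) auto
      show "emeasure M {x \<in> B. Q k x} \<noteq> \<infinity>" for k using fin[of "Q k"] by simp
    qed (use that(1) in auto)
    then have "\<forall>\<^sub>F k in sequentially. measure M {x \<in> B. Q k x} < b"
      unfolding eq using that(4) by (intro order_tendstoD) auto
    then show ?thesis by (rule eventually_happens'[rotated]) simp
  qed
  show ?thesis
  proof (cases "measure M B = 0")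
    case True
    have "measure M {x \<in> B. 0 < u x} \<le> measure M B" "measure M {x \<in> B. u x < 0} \<le> measure M B"
      using B gt lt by (intro measure_mono_fmeasurable; auto)+
    then show ?thesis using True by (intro exI[of _ 0]) auto
  next
    case False
    then have pos: "0 < measure M B / 2" by (simp add: zero_less_measure_iff)
    define S where "S = {t. measure M {x \<in> B. t < u x} \<le> measure M B / 2}"
    have "\<exists>k. \<not> real k < u x" for x using real_arch_simple[of "u x"] by (auto simp: not_less)
    then obtain k where "measure M {x \<in> B. real k < u x} < measure M B / 2"
      using to_empty[of "\<lambda>k x. real k < u x", OF gt _ _ pos] by auto
    then have Sne: "S \<noteq> {}" by (auto simp: S_def intro: less_imp_le)
    have "\<exists>k. \<not> u x \<le> - real k" for x
    proof -
      obtain k where "- u x < real k" using reals_Archimedean2 by blast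
      then show ?thesis by (intro exI[of _ k]) linarith
    qed
    then obtain k where k: "measure M {x \<in> B. u x \<le> - real k} < measure M B / 2"
      using to_empty[of "\<lambda>k x. u x \<le> - real k", OF le _ _ pos] by auto
    have "- real k \<le> t" if "t \<in> S" for t
    proof (rule ccontr)
      assume "\<not> - real k \<le> t"
      then have "measure M {x \<in> B. u x \<le> t} \<le> measure M {x \<in> B. u x \<le> - real k}"
        by (intro mono le) auto
      then show False using k that split[of t] by (simp add: S_def)
    qed
    then have Sbd: "bdd_below S" by (rule bdd_belowI)
    define m where "m = Inf S"
    have up: "measure M {x \<in> B. t < u x} \<le> measure M B / 2" if t: "m < t" for t
    proof -
      obtain s where s: "s \<in> S" "s < t" using t cInf_lessD[OF Sne] unfolding m_def by blast
      have "measure M {x \<in> B. t < u x} \<le> measure M {x \<in> B. s < u x}"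
        using s by (intro mono gt) auto
      then show ?thesis using s by (simp add: S_def)
    qed
    have down: "measure M {x \<in> B. u x \<le> t} \<le> measure M B / 2" if t: "t < m" for t
    proof -
      have "t \<notin> S" using t cInf_lower[OF _ Sbd, of t] unfolding m_def by auto
      then show ?thesis unfolding split by (simp add: S_def)
    qed
    have inv: "inverse (real (Suc (Suc k))) \<le> inverse (real (Suc k))" for k
      by (intro le_imp_inverse_le) auto
    have "\<exists>k. inverse (real (Suc k)) < e" if "0 < e" for e using reals_Archimedean that by blast
    then have ex: "0 < e \<longleftrightarrow> (\<exists>k. inverse (real (Suc k)) < e)" "0 < e \<longleftrightarrow> (\<exists>k. inverse (real (Suc k)) \<le> e)" for e :: real
      by (meson inverse_positive_iff_positive less_imp_le less_le_trans less_trans of_nat_0_less_iff zero_less_Suc)+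
    have "measure M {x \<in> B. m < u x} \<le> measure M B / 2"
    proof (rule from_below[of "\<lambda>k x. m + inverse (real (Suc k)) < u x", OF gt])
      show "m < u x \<longleftrightarrow> (\<exists>k. m + inverse (real (Suc k)) < u x)" for x
        using ex(1)[of "u x - m"] by (simp add: algebra_simps)
    next
      fix k x assume "m + inverse (real (Suc k)) < u x"
      then show "m + inverse (real (Suc (Suc k))) < u x" using inv[of k] by linarith
    qed (rule up, simp)
    moreover have "measure M {x \<in> B. u x < m} \<le> measure M B / 2"
    proof (rule from_below[of "\<lambda>k x. u x \<le> m - inverse (real (Suc k))", OF le])
      show "u x < m \<longleftrightarrow> (\<exists>k. u x \<le> m - inverse (real (Suc k)))" for x
        using ex(2)[of "m - u x"] by (simp add: algebra_simps)
    next
      fix k x assume "u x \<le> m - inverse (real (Suc k))"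
      then show "u x \<le> m - inverse (real (Suc (Suc k)))" using inv[of k] by linarith
    qed (rule down, simp)
    ultimately show ?thesis by blast
  qed
qed

section \<open>The coarea formula and the inequality for medians\<close>

definition jump_energy :: "'a::euclidean_space set \<Rightarrow> real \<Rightarrow> real \<Rightarrow> ('a \<Rightarrow> real) \<Rightarrow> ennreal" where
  "jump_energy G \<tau> \<delta> u =
     (\<integral>\<^sup>+(x, y). jump_kernel G \<tau> \<delta> (x, y) * ennreal \<bar>u x - u y\<bar> \<partial>(lborel \<Otimes>\<^sub>M lborel))"

text \<open>The coarea formula: \<open>\<bar>u x - u y\<bar>\<close> is the length of the set of levels \<open>t\<close> that separate \<open>u x\<close> from
  \<open>u y\<close>. The kernel vanishes unless both points are in \<open>G\<close>, so intersecting the superlevel sets with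
  \<open>G\<close> changes nothing.\<close>

lemma superlevel_jump_perimeter:
  fixes G :: "'a::euclidean_space set"
  assumes G: "open G" and \<tau>: "0 < \<tau>" "\<tau> < 1" and u[measurable]: "u \<in> borel_measurable borel"
  shows borel_measurable_superlevel_jump_perimeter:
      "(\<lambda>t. jump_perimeter G \<tau> \<delta> {x \<in> G. t < u x}) \<in> borel_measurable borel" (is ?meas)
    and nn_integral_superlevel_jump_perimeter:
      "(\<integral>\<^sup>+t. jump_perimeter G \<tau> \<delta> {x \<in> G. t < u x} \<partial>lborel) = jump_energy G \<tau> \<delta> u" (is ?coarea)
proof -
  have [measurable]: "G \<in> sets borel" using G by simp
  interpret P: pair_sigma_finite "lborel \<Otimes>\<^sub>M lborel :: ('a \<times> 'a) measure" lborel
    unfolding lborel_prod by unfold_locales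
  let ?f = "\<lambda>p t. jump_kernel G \<tau> \<delta> p * (if (t < u (fst p)) \<noteq> (t < u (snd p)) then 1 else 0)"
  have [measurable]: "case_prod ?f \<in> borel_measurable ((lborel \<Otimes>\<^sub>M lborel) \<Otimes>\<^sub>M lborel)"
    by measurable
  have per: "jump_perimeter G \<tau> \<delta> {x \<in> G. t < u x} = (\<integral>\<^sup>+p. ?f p t \<partial>(lborel \<Otimes>\<^sub>M lborel))" for t
    unfolding jump_perimeter_def
  proof (intro nn_integral_cong)
    fix p :: "'a \<times> 'a"
    have "y \<in> G" if "x \<in> G" "dist x y < \<tau> * infdist x (frontier G)" for x y
      using ball_scaled_infdist_frontier_subset[of x G \<tau>] that \<tau> by auto
    then show "jump_kernel G \<tau> \<delta> p * indicator {(x, y). (x \<in> {x \<in> G. t < u x}) \<noteq> (y \<in> {x \<in> G. t < u x})} p = ?f p t"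
      by (cases p) (auto simp: jump_kernel_def indicator_def)
  qed
  show ?meas unfolding per by measurable
  have "(\<integral>\<^sup>+t. jump_perimeter G \<tau> \<delta> {x \<in> G. t < u x} \<partial>lborel)
      = (\<integral>\<^sup>+p. \<integral>\<^sup>+t. ?f p t \<partial>lborel \<partial>(lborel \<Otimes>\<^sub>M lborel))"
    unfolding per by (rule P.Fubini') measurable
  also have "\<dots> = (\<integral>\<^sup>+p. jump_kernel G \<tau> \<delta> p * ennreal \<bar>u (fst p) - u (snd p)\<bar> \<partial>(lborel \<Otimes>\<^sub>M lborel))"
  proof (intro nn_integral_cong)
    fix p :: "'a \<times> 'a"
    let ?I = "{min (u (fst p)) (u (snd p))..<max (u (fst p)) (u (snd p))}"
    have "(\<integral>\<^sup>+t. ?f p t \<partial>lborel) = (\<integral>\<^sup>+t. jump_kernel G \<tau> \<delta> p * indicator ?I t \<partial>lborel)"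
      by (intro nn_integral_cong) (auto simp: indicator_def)
    also have "\<dots> = jump_kernel G \<tau> \<delta> p * emeasure lborel ?I"
      by (rule nn_integral_cmult_indicator) simp
    also have "emeasure lborel ?I = ennreal \<bar>u (fst p) - u (snd p)\<bar>"
      by (simp add: max_def min_def abs_if)
    finally show "(\<integral>\<^sup>+t. ?f p t \<partial>lborel) = jump_kernel G \<tau> \<delta> p * ennreal \<bar>u (fst p) - u (snd p)\<bar>" .
  qed
  finally show ?coarea by (simp add: jump_energy_def split_beta')
qed

lemma isoperimetric_const_pos:
  assumes "0 < \<tau>" "1 \<le> c" "0 \<le> n"
  shows "0 < isoperimetric_const n c \<tau> \<delta>"
  unfolding isoperimetric_const_def using assms
  by (intro mult_pos_pos) (use unit_ball_vol_pos[OF assms(3)] in \<open>auto simp: less_le\<close>)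

text \<open>All superlevel sets of positive level fill at most half of the central ball, so the
  isoperimetric inequality bounds the \<open>1/q\<close>-th power of their measure by their perimeter.
  Integrating over the levels turns the perimeters into the energy of \<open>u\<close>, and the superlevel sets
  into the \<open>L\<^sup>q\<close> norm of the positive part.\<close>

lemma nn_integral_pos_part_powr_le_jump_energy:
  fixes G :: "'a::euclidean_space set"
  assumes \<tau>: "0 < \<tau>" "\<tau> < 1" and \<delta>: "0 < \<delta>" "\<delta> < real DIM('a)" and c: "1 \<le> c"
    and G: "open G" "bounded G" and T: "0 < T"
    and curves: "\<And>x. x \<in> G \<Longrightarrow> \<exists>\<gamma>. continuous_on {0..T} \<gamma> \<and> \<gamma> T = w \<and>
        (\<forall>t\<in>{0..T}. dist x (\<gamma> t) \<le> t \<and> infdist (\<gamma> t) (frontier G) \<ge> t / c)"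
    and u[measurable]: "u \<in> borel_measurable borel"
    and half: "measure lborel {x \<in> ball w (\<tau> / (3 * c) * T). 0 < u x} \<le> measure lborel (ball w (\<tau> / (3 * c) * T)) / 2"
  defines "n \<equiv> real DIM('a)"
  shows "(\<integral>\<^sup>+x\<in>G. ennreal (max 0 (u x) powr (n / (n - \<delta>))) \<partial>lborel)
     \<le> ennreal (isoperimetric_const n c \<tau> \<delta>) * ennreal_powr (jump_energy G \<tau> \<delta> u) (n / (n - \<delta>))"
proof -
  define q where "q = n / (n - \<delta>)"
  have q: "1 < q" using \<delta> by (simp add: q_def n_def field_simps)
  define K where "K = isoperimetric_const n c \<tau> \<delta>"
  have K: "K > 0" unfolding K_def n_def using \<tau> c by (intro isoperimetric_const_pos) auto
  have [measurable]: "G \<in> sets borel" using G by simp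
  have Gfin: "emeasure lborel G < \<infinity>" using G(2) by (rule emeasure_bounded_finite)
  let ?A = "\<lambda>t. {x \<in> G. t < u x}"
  have perA: "ennreal (measure lborel (?A s) powr (1/q)) \<le> ennreal (K powr (1/q)) * jump_perimeter G \<tau> \<delta> (?A s)"
    if s: "0 < s" for s
  proof (cases "jump_perimeter G \<tau> \<delta> (?A s)")
    case top
    then show ?thesis using K by (simp add: ennreal_mult_top)
  next
    case (real J)
    have "measure lborel (?A s \<inter> ball w (\<tau> / (3 * c) * T)) \<le> measure lborel {x \<in> ball w (\<tau> / (3 * c) * T). 0 < u x}"
    proof (rule measure_mono_fmeasurable)
      have "emeasure lborel {x \<in> ball w (\<tau> / (3 * c) * T). 0 < u x} < \<infinity>"
        by (rule emeasure_bounded_finite) (auto intro: bounded_subset[OF bounded_ball])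
      then show "{x \<in> ball w (\<tau> / (3 * c) * T). 0 < u x} \<in> fmeasurable lborel"
        by (auto simp: fmeasurable_def)
    qed (use s in auto)
    also note half
    finally have "measure lborel (?A s) \<le> K * J powr q"
      unfolding K_def q_def n_def
    proof (intro measure_le_jump_perimeter_powr[OF \<tau> \<delta> c G T, where w = w])
      show "\<exists>\<gamma>. continuous_on {0..T} \<gamma> \<and> \<gamma> T = w \<and>
        (\<forall>t\<in>{0..T}. dist x (\<gamma> t) \<le> t \<and> infdist (\<gamma> t) (frontier G) \<ge> t / c)" if "x \<in> G" for x
        using that by (rule curves)
    qed (use real in auto)
    then have "measure lborel (?A s) powr (1/q) \<le> (K * J powr q) powr (1/q)"
      using q by (intro powr_mono2) auto
    also have "\<dots> = K powr (1/q) * J" using K real q by (simp add: powr_mult powr_powr)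
    finally show ?thesis using K real by (simp add: ennreal_mult[symmetric] ennreal_leI)
  qed
  have "(\<integral>\<^sup>+x\<in>G. ennreal (max 0 (u x) powr q) \<partial>lborel) \<le> ennreal K * ennreal_powr (jump_energy G \<tau> \<delta> u) q"
  proof (cases "jump_energy G \<tau> \<delta> u")
    case top
    then show ?thesis using K by (simp add: ennreal_powr_def ennreal_mult_top)
  next
    case (real E)
    define v where "v x = indicator G x * max 0 (u x)" for x
    have [measurable]: "v \<in> borel_measurable borel" unfolding v_def[abs_def] by measurable
    have sup: "{x \<in> space lborel. s < v x} = ?A s" if "0 \<le> s" for s
      using that by (auto simp: v_def indicator_def)
    have "(\<integral>\<^sup>+x\<in>G. ennreal (max 0 (u x) powr q) \<partial>lborel) = (\<integral>\<^sup>+x. ennreal (v x powr q) \<partial>lborel)"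
      by (intro nn_integral_cong) (auto simp: v_def indicator_def)
    also have "\<dots> \<le> ennreal ((K powr (1/q) * E) powr q)"
    proof (rule nn_integral_powr_le_superlevel_integral[OF _ _ _ _ q])
      show "sigma_finite_measure (lborel :: 'a measure)" by unfold_locales
      show "0 \<le> v x" for x by (simp add: v_def)
      have "emeasure lborel (?A 0) \<le> emeasure lborel G" by (intro emeasure_mono) auto
      then show "emeasure lborel {x \<in> space lborel. 0 < v x} < \<infinity>"
        using Gfin sup[of 0] by simp
      have "(\<integral>\<^sup>+s\<in>{0<..}. ennreal (measure lborel {x \<in> space lborel. s < v x} powr (1/q)) \<partial>lborel)
          \<le> (\<integral>\<^sup>+s. ennreal (K powr (1/q)) * jump_perimeter G \<tau> \<delta> (?A s) \<partial>lborel)"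
        by (intro nn_integral_mono) (use perA sup in \<open>auto simp: indicator_def simp del: space_lborel\<close>)
      also have "\<dots> = ennreal (K powr (1/q)) * ennreal E"
        using borel_measurable_superlevel_jump_perimeter[OF G(1) \<tau> u, of \<delta>]
        by (simp add: nn_integral_cmult nn_integral_superlevel_jump_perimeter[OF G(1) \<tau> u] real)
      finally show "(\<integral>\<^sup>+s\<in>{0<..}. ennreal (measure lborel {x \<in> space lborel. s < v x} powr (1/q)) \<partial>lborel)
          \<le> ennreal (K powr (1/q) * E)" using real by (simp add: ennreal_mult)
    qed (use K real in auto)
    also have "(K powr (1/q) * E) powr q = K * E powr q"
      using K real q by (simp add: powr_mult powr_powr)
    finally show ?thesis using real K by (simp add: ennreal_powr_def ennreal_mult)
  qed
  then show ?thesis by (simp add: q_def K_def)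
qed

text \<open>The number \<open>m\<close> is a median of \<open>u\<close> on the central ball: then \<open>u - m\<close> and \<open>m - u\<close> are both positive on
  at most half of this ball, and the bound for positive parts applies to each of them.\<close>

lemma nn_integral_median_powr_le_jump_energy:
  fixes G :: "'a::euclidean_space set"
  assumes \<tau>: "0 < \<tau>" "\<tau> < 1" and \<delta>: "0 < \<delta>" "\<delta> < real DIM('a)"
    and J: "john_domain c G" and u[measurable]: "u \<in> borel_measurable borel"
  defines "n \<equiv> real DIM('a)"
  shows "\<exists>m. (\<integral>\<^sup>+x\<in>G. ennreal (\<bar>u x - m\<bar> powr (n / (n - \<delta>))) \<partial>lborel)
     \<le> ennreal (2 * isoperimetric_const n c \<tau> \<delta>) * ennreal_powr (jump_energy G \<tau> \<delta> u) (n / (n - \<delta>))"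
proof -
  from J have c: "1 \<le> c" and G: "open G" "bounded G" by (auto simp: john_domain_def)
  then have [measurable]: "G \<in> sets borel" by simp
  obtain w T where T: "0 < T" and curves: "\<And>x. x \<in> G \<Longrightarrow> \<exists>\<gamma>. continuous_on {0..T} \<gamma> \<and> \<gamma> T = w \<and>
        (\<forall>t\<in>{0..T}. dist x (\<gamma> t) \<le> t \<and> infdist (\<gamma> t) (frontier G) \<ge> t / c)"
    by (rule john_domain_curves[OF J]) blast
  let ?B = "ball w (\<tau> / (3 * c) * T)"
  define q where "q = n / (n - \<delta>)"
  have q: "0 < q" using \<delta> by (simp add: q_def n_def)
  define K where "K = isoperimetric_const n c \<tau> \<delta>"
  have K: "K > 0" unfolding K_def n_def using \<tau> c by (intro isoperimetric_const_pos) auto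
  have "?B \<in> fmeasurable lborel" using emeasure_lborel_ball_finite by (auto simp: fmeasurable_def)
  from median_exists[OF this, of u] obtain m
    where m: "measure lborel {x \<in> ?B. m < u x} \<le> measure lborel ?B / 2"
      "measure lborel {x \<in> ?B. u x < m} \<le> measure lborel ?B / 2" by auto
  let ?E = "ennreal_powr (jump_energy G \<tau> \<delta> u) q"
  have energy: "jump_energy G \<tau> \<delta> (\<lambda>x. u x - m) = jump_energy G \<tau> \<delta> u"
    "jump_energy G \<tau> \<delta> (\<lambda>x. m - u x) = jump_energy G \<tau> \<delta> u"
    by (simp_all add: jump_energy_def abs_minus_commute)
  have up: "(\<integral>\<^sup>+x\<in>G. ennreal (max 0 (u x - m) powr q) \<partial>lborel) \<le> ennreal K * ?E"
    using nn_integral_pos_part_powr_le_jump_energy[OF \<tau> \<delta> c G T curves, of "\<lambda>x. u x - m"] m(1)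
    by (simp add: energy K_def q_def n_def)
  have down: "(\<integral>\<^sup>+x\<in>G. ennreal (max 0 (m - u x) powr q) \<partial>lborel) \<le> ennreal K * ?E"
    using nn_integral_pos_part_powr_le_jump_energy[OF \<tau> \<delta> c G T curves, of "\<lambda>x. m - u x"] m(2)
    by (simp add: energy K_def q_def n_def)
  have "(\<integral>\<^sup>+x\<in>G. ennreal (\<bar>u x - m\<bar> powr q) \<partial>lborel)
     = (\<integral>\<^sup>+x. ennreal (max 0 (u x - m) powr q) * indicator G x + ennreal (max 0 (m - u x) powr q) * indicator G x \<partial>lborel)"
    using q by (intro nn_integral_cong) (auto simp: indicator_def max_def)
  also have "\<dots> = (\<integral>\<^sup>+x\<in>G. ennreal (max 0 (u x - m) powr q) \<partial>lborel) + (\<integral>\<^sup>+x\<in>G. ennreal (max 0 (m - u x) powr q) \<partial>lborel)"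
    by (rule nn_integral_add) measurable
  also have "\<dots> \<le> ennreal K * ?E + ennreal K * ?E" by (intro add_mono up down)
  also have "\<dots> = ennreal (2 * K) * ?E"
  proof -
    have "ennreal (2 * K) = ennreal K + ennreal K" using K by (subst ennreal_plus[symmetric]) auto
    then show ?thesis by (simp only: distrib_right)
  qed
  finally show ?thesis unfolding q_def K_def by (rule exI[of _ m])
qed

section \<open>The inequality for averages\<close>

text \<open>The double integral is unchanged when \<open>u\<close> is replaced by a Borel function \<open>w\<close> that agrees with it
  almost everywhere in \<open>G\<close>, since the inner balls lie in \<open>G\<close>. For \<open>w\<close> Tonelli's theorem on the product of
  Borel measures applies.\<close>

lemma iterated_integral_eq_jump_energy:
  fixes G :: "'a::euclidean_space set"
  assumes G: "open G" and \<tau>: "0 < \<tau>" "\<tau> < 1" and w[measurable]: "w \<in> borel_measurable borel"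
    and uw: "AE x in lborel. x \<in> G \<longrightarrow> u x = w x"
  shows "(\<integral>\<^sup>+x\<in>G. (\<integral>\<^sup>+y\<in>ball x (\<tau> * infdist x (frontier G)).
           ennreal (\<bar>u x - u y\<bar> / norm (x - y) powr (real DIM('a) + \<delta>)) \<partial>lebesgue) \<partial>lebesgue)
    = jump_energy G \<tau> \<delta> w"
proof -
  have [measurable]: "G \<in> sets borel" using G by simp
  have sub: "ball x (\<tau> * infdist x (frontier G)) \<subseteq> G" if "x \<in> G" for x
    using ball_scaled_infdist_frontier_subset[of x G \<tau>] that \<tau> by auto
  have inner: "(\<integral>\<^sup>+y\<in>ball x (\<tau> * infdist x (frontier G)).
           ennreal (\<bar>u x - u y\<bar> / norm (x - y) powr (real DIM('a) + \<delta>)) \<partial>lborel)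
     = (\<integral>\<^sup>+y. jump_kernel G \<tau> \<delta> (x, y) * ennreal \<bar>w x - w y\<bar> \<partial>lborel)"
    if x: "x \<in> G" "u x = w x" for x
  proof (rule nn_integral_cong_AE)
    show "AE y in lborel. ennreal (\<bar>u x - u y\<bar> / norm (x - y) powr (real DIM('a) + \<delta>)) *
        indicator (ball x (\<tau> * infdist x (frontier G))) y = jump_kernel G \<tau> \<delta> (x, y) * ennreal \<bar>w x - w y\<bar>"
      using uw
    proof eventually_elim
      case (elim y)
      then show ?case using x sub[OF x(1)]
        by (auto simp: jump_kernel_def indicator_def ennreal_mult[symmetric])
    qed
  qed
  have "(\<integral>\<^sup>+x\<in>G. (\<integral>\<^sup>+y\<in>ball x (\<tau> * infdist x (frontier G)).
           ennreal (\<bar>u x - u y\<bar> / norm (x - y) powr (real DIM('a) + \<delta>)) \<partial>lebesgue) \<partial>lebesgue)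
    = (\<integral>\<^sup>+x. (\<integral>\<^sup>+y. jump_kernel G \<tau> \<delta> (x, y) * ennreal \<bar>w x - w y\<bar> \<partial>lborel) \<partial>lborel)"
    unfolding nn_integral_completion
  proof (rule nn_integral_cong_AE)
    show "AE x in lborel. (\<integral>\<^sup>+y\<in>ball x (\<tau> * infdist x (frontier G)).
           ennreal (\<bar>u x - u y\<bar> / norm (x - y) powr (real DIM('a) + \<delta>)) \<partial>lborel) * indicator G x
       = (\<integral>\<^sup>+y. jump_kernel G \<tau> \<delta> (x, y) * ennreal \<bar>w x - w y\<bar> \<partial>lborel)"
      using uw
    proof eventually_elim
      case (elim x)
      show ?case
      proof (cases "x \<in> G")
        case True with elim inner[of x] show ?thesis by simp
      next
        case False then show ?thesis by (simp add: jump_kernel_def)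
      qed
    qed
  qed
  also have "\<dots> = jump_energy G \<tau> \<delta> w"
    unfolding jump_energy_def
    using lborel.nn_integral_fst[of "\<lambda>(x, y). jump_kernel G \<tau> \<delta> (x, y) * ennreal \<bar>w x - w y\<bar>" lborel]
    by (simp add: split_beta')
  finally show ?thesis .
qed

theorem theorem5p1:
  fixes c \<tau> \<delta> n :: real
  assumes "CARD('n::finite) \<ge> 2" and "n = real CARD('n)"
    and "c \<ge> 1" and "0 < \<tau>" "\<tau> < 1" and "0 < \<delta>" "\<delta> < 1"
  shows "\<exists>C>0. \<forall>(G :: (real ^ 'n) set) (u :: real ^ 'n \<Rightarrow> real).
    john_domain c G \<longrightarrow> set_integrable lebesgue G u \<longrightarrow>
      (\<integral>\<^sup>+x\<in>G. ennreal (\<bar>u x - integral_average G u\<bar> powr (n / (n - \<delta>))) \<partial>lebesgue)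
      \<le> ennreal C *
        ennreal_powr
          (\<integral>\<^sup>+x\<in>G.
             (\<integral>\<^sup>+y\<in>ball x (\<tau> * infdist x (frontier G)).
                ennreal (\<bar>u x - u y\<bar> / norm (x - y) powr (n + \<delta>)) \<partial>lebesgue) \<partial>lebesgue)
          (n / (n - \<delta>))"
proof -
  have n: "n = real DIM(real ^ 'n)" using assms(2) by simp
  have \<delta>: "0 < \<delta>" "\<delta> < real DIM(real ^ 'n)" using assms by auto
  define q where "q = n / (n - \<delta>)"
  have q: "1 < q" using assms \<delta> by (simp add: q_def field_simps)
  define K where "K = isoperimetric_const n c \<tau> \<delta>"
  have K: "K > 0" unfolding K_def using assms by (intro isoperimetric_const_pos) auto
  define C where "C = 2 powr (q + 1) * (2 * K)"
  show ?thesis unfolding q_def[symmetric]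
  proof (intro exI[of _ C] conjI allI impI)
    show "C > 0" using K by (simp add: C_def)
    fix G :: "(real ^ 'n) set" and u :: "real ^ 'n \<Rightarrow> real"
    assume J: "john_domain c G" and u: "set_integrable lebesgue G u"
    from J have G: "open G" "bounded G" "G \<noteq> {}" by (auto simp: john_domain_def)
    have Gl: "G \<in> lmeasurable" using G by (intro lmeasurable_open)
    have "0 < measure lborel G"
      using open_not_negligible[OF G(1,3)] Gl G(1) by (simp add: negligible_iff_measure zero_less_measure_iff)
    have "(\<lambda>x. indicator G x *\<^sub>R u x) \<in> borel_measurable lebesgue"
      using u by (auto simp: set_integrable_def)
    from completion_ex_borel_measurable_real[OF this] obtain w where w: "w \<in> borel_measurable borel"
      "AE x in lborel. indicator G x *\<^sub>R u x = w x" by auto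
    have uw: "AE x in lborel. x \<in> G \<longrightarrow> u x = w x"
      using w(2) by eventually_elim (auto simp: indicator_def)
    let ?E = "jump_energy G \<tau> \<delta> w"
    obtain m where m: "(\<integral>\<^sup>+x\<in>G. ennreal (\<bar>w x - m\<bar> powr q) \<partial>lborel) \<le> ennreal (2 * K) * ennreal_powr ?E q"
      using nn_integral_median_powr_le_jump_energy[OF assms(4,5) \<delta> J w(1)]
      unfolding n[symmetric] q_def[symmetric] K_def[symmetric] by blast
    have "(\<integral>\<^sup>+x\<in>G. ennreal (\<bar>u x - integral_average G u\<bar> powr q) \<partial>lebesgue)
      \<le> ennreal (2 powr (q + 1)) * (\<integral>\<^sup>+x\<in>G. ennreal (\<bar>u x - m\<bar> powr q) \<partial>lebesgue)"
      unfolding integral_average_def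
      by (rule nn_integral_powr_deviation_average_le[OF _ _ _ u q])
        (use Gl \<open>0 < measure lborel G\<close> G in \<open>auto simp: fmeasurable_def\<close>)
    also have "(\<integral>\<^sup>+x\<in>G. ennreal (\<bar>u x - m\<bar> powr q) \<partial>lebesgue) = (\<integral>\<^sup>+x\<in>G. ennreal (\<bar>w x - m\<bar> powr q) \<partial>lborel)"
      unfolding nn_integral_completion
    proof (rule nn_integral_cong_AE)
      show "AE x in lborel. ennreal (\<bar>u x - m\<bar> powr q) * indicator G x = ennreal (\<bar>w x - m\<bar> powr q) * indicator G x"
        using uw by eventually_elim (auto simp: indicator_def)
    qed
    also have "ennreal (2 powr (q + 1)) * \<dots> \<le> ennreal (2 powr (q + 1)) * (ennreal (2 * K) * ennreal_powr ?E q)"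
      by (intro mult_left_mono m) simp
    also have "\<dots> = ennreal C * ennreal_powr ?E q"
      using K by (simp add: C_def ennreal_mult mult.assoc)
    also have "?E = (\<integral>\<^sup>+x\<in>G. (\<integral>\<^sup>+y\<in>ball x (\<tau> * infdist x (frontier G)).
                ennreal (\<bar>u x - u y\<bar> / norm (x - y) powr (n + \<delta>)) \<partial>lebesgue) \<partial>lebesgue)"
      unfolding n by (rule iterated_integral_eq_jump_energy[OF G(1) assms(4,5) w(1) uw, symmetric])
    finally show "(\<integral>\<^sup>+x\<in>G. ennreal (\<bar>u x - integral_average G u\<bar> powr q) \<partial>lebesgue)
      \<le> ennreal C * ennreal_powr
          (\<integral>\<^sup>+x\<in>G. (\<integral>\<^sup>+y\<in>ball x (\<tau> * infdist x (frontier G)).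
                ennreal (\<bar>u x - u y\<bar> / norm (x - y) powr (n + \<delta>)) \<partial>lebesgue) \<partial>lebesgue) q" .
  qed
qed

end
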